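(* Let $d\ge 2$ be an integer, let $C>0$ and $0\le s,t\le d$, and suppose that $s>\frac{d+1}{2}$ and $t>\frac{d+1}{2}$. Then there exists $\delta_0=\delta_0(C,s,t)>0$ (which may also depend on $d$) such that for all constants $C_P,C_\Pi>0$ there is a constant $K>0$, depending only on $d,C,s,t,C_P,C_\Pi$, with the following property. For every $\delta\in(0,\delta_0)$, every $\delta$-separated $(\delta,s,C_P)$-set $P$ of points in $B(0,1)\subset\mathbb{R}^d$, and every $\delta$-separated $(\delta,t,C_\Pi)$-set $\Pi$ of affine hyperplanes of $\mathbb{R}^d$ each intersecting $B(0,1)$, one has $$I_{C\delta}(P,\Pi)\le K\,\delta\,|P|\,|\Pi|,$$ where $I_{C\delta}(P,\Pi)=\#\{(p,\pi)\in P\times\Pi\colon p\in\pi(C\delta)\}$.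
   Context: $B(0,1)$ is the unit ball of $\mathbb{R}^d$ centered at the origin, $|\cdot|$ of a finite set denotes cardinality, and $\pi(C\delta)$ denotes the $C\delta$-neighborhood of the hyperplane $\pi$ in $\mathbb{R}^d$. Definition ($(\delta,s,C)$-set). Let $0\le s<\infty$, $\delta\in(0,1)$, $C>0$, and let $(X,d)$ be a metric space. A bounded set $E\subset X$ is called a $(\delta,s,C)$-set if for every $\delta\le r\le 1$ and every ball $B\subset X$ of radius $r$, $$|E\cap B|_\delta\le C r^s|E|_\delta,$$ where $|E|_\delta$ denotes the $\delta$-covering number of $E$ (the minimal number of balls of radius $\delta$ needed to cover $E$). A subset of a metric space is $\delta$-separated if any two distinct elements are at distance at least $\delta$. Points are considered in $\mathbb{R}^d$ with the Euclidean metric. Hyperplanes are considered in the space $\mathcal{A}(d,d-1)$ of affine hyperplanes of $\mathbb{R}^d$ with the metric $$d_{\mathcal{A}}(V,W)=\|\pi_{V_0}-\pi_{W_0}\|_{op}+|a-b|,$$ where $V=V_0+a$, $W=W_0+b$, $V_0,W_0$ are $(d-1)$-dimensional linear subspaces, $a\in V_0^\perp$, $b\in W_0^\perp$, $\pi_{V_0},\pi_{W_0}$ are the orthogonal projections onto $V_0,W_0$, and $\|\cdot\|_{op}$ is the operator norm. *)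

theory Defs
  imports "HOL-Analysis.Analysis"
begin

section \<open>Covering numbers and $(\delta,s,C)$-sets in a metric space\<close>

context Metric_space
begin

text \<open>Balls are closed, and the centres of covering balls are arbitrary points of the ambient
  space \<open>M\<close>. The value is \<open>\<infinity>\<close> (the infimum of the empty set) if no finite cover exists.\<close>

definition covering_number :: "real \<Rightarrow> 'a set \<Rightarrow> enat" where
  "covering_number \<delta> E =
     (INF F \<in> {F. finite F \<and> F \<subseteq> M \<and> E \<subseteq> (\<Union>x\<in>F. mcball x \<delta>)}. enat (card F))"

text \<open>\<open>mbounded E\<close> includes \<open>E \<subseteq> M\<close>. The first four conjuncts are the range of
  the parameters for which the notion is defined.\<close>

definition delta_set :: "real \<Rightarrow> real \<Rightarrow> real \<Rightarrow> 'a set \<Rightarrow> bool" where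
  "delta_set \<delta> s C E \<longleftrightarrow>
     0 \<le> s \<and> 0 < \<delta> \<and> \<delta> < 1 \<and> 0 < C \<and> mbounded E \<and>
     (\<forall>r x. \<delta> \<le> r \<and> r \<le> 1 \<and> x \<in> M \<longrightarrow>
        ereal_of_enat (covering_number \<delta> (E \<inter> mcball x r))
          \<le> ereal (C * r powr s) * ereal_of_enat (covering_number \<delta> E))"

definition separated :: "real \<Rightarrow> 'a set \<Rightarrow> bool" where
  "separated \<delta> E \<longleftrightarrow> E \<subseteq> M \<and> (\<forall>x\<in>E. \<forall>y\<in>E. x \<noteq> y \<longrightarrow> \<delta> \<le> d x y)"

end


section \<open>The metric space of affine hyperplanes\<close>

definition hyperplanes :: "'a::euclidean_space set set" where
  "hyperplanes = {V. affine V \<and> aff_dim V = int DIM('a) - 1}"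

text \<open>For an affine set \<open>V = V\<^sub>0 + a\<close> the differences \<open>x - y\<close> already form the linear
  subspace \<open>V\<^sub>0\<close>; taking the span makes this a subspace for every argument.
  See \<open>hyperplane_decomposition\<close> below.\<close>

definition direction :: "'a::euclidean_space set \<Rightarrow> 'a set" where
  "direction V = span {x - y |x y. x \<in> V \<and> y \<in> V}"

text \<open>The representative \<open>a \<in> V\<^sub>0\<^sup>\<bottom>\<close> in \<open>V = V\<^sub>0 + a\<close> is the unique point of
  \<open>V \<inter> V\<^sub>0\<^sup>\<bottom>\<close>.\<close>

definition offset :: "'a::euclidean_space set \<Rightarrow> 'a" where
  "offset V = (THE a. a \<in> V \<and> a \<in> (direction V)\<^sup>\<bottom>)"

definition orth_proj :: "'a::euclidean_space set \<Rightarrow> 'a \<Rightarrow> 'a" where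
  "orth_proj S x = (THE y. y \<in> S \<and> x - y \<in> S\<^sup>\<bottom>)"

definition hyperplane_dist :: "'a::euclidean_space set \<Rightarrow> 'a set \<Rightarrow> real" where
  "hyperplane_dist V W =
     onorm (\<lambda>x. orth_proj (direction V) x - orth_proj (direction W) x)
       + norm (offset V - offset W)"


section \<open>Incidences\<close>

definition nbhd :: "'a::euclidean_space set \<Rightarrow> real \<Rightarrow> 'a set" where
  "nbhd V r = {x. infdist x V \<le> r}"

definition incidences :: "real \<Rightarrow> 'a::euclidean_space set \<Rightarrow> 'a set set \<Rightarrow> nat" where
  "incidences r P H = card {(p, V). p \<in> P \<and> V \<in> H \<and> p \<in> nbhd V r}"


section \<open>Well-definedness\<close>

lemma orth_proj_unique:
  assumes "subspace S" "y \<in> S" "x - y \<in> S\<^sup>\<bottom>"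
  shows "orth_proj S x = y"
  unfolding orth_proj_def
proof (rule the_equality)
  show "y \<in> S \<and> x - y \<in> S\<^sup>\<bottom>" using assms by simp
  fix z assume z: "z \<in> S \<and> x - z \<in> S\<^sup>\<bottom>"
  have "z - y \<in> S" using z assms by (simp add: subspace_diff)
  moreover have "(x - y) - (x - z) \<in> S\<^sup>\<bottom>"
    using z assms subspace_orthogonal_comp subspace_diff by blast
  hence "z - y \<in> S\<^sup>\<bottom>" by simp
  ultimately have "orthogonal (z - y) (z - y)" by (auto simp: orthogonal_comp_def)
  thus "z = y" by (simp add: orthogonal_self)
qed

lemma orth_proj_in:
  assumes "subspace S"
  shows "orth_proj S x \<in> S" "x - orth_proj S x \<in> S\<^sup>\<bottom>"
proof -
  obtain y z where yz: "y \<in> span S" "\<And>w. w \<in> span S \<Longrightarrow> orthogonal z w" "x = y + z"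
    using orthogonal_subspace_decomp_exists [of S x] by metis
  have "y \<in> S" using yz(1) assms by (metis span_eq_iff)
  moreover have "x - y \<in> S\<^sup>\<bottom>"
    using yz(2,3) by (auto simp: orthogonal_comp_def orthogonal_commute span_base)
  ultimately have "orth_proj S x = y" using assms orth_proj_unique by blast
  with \<open>y \<in> S\<close> \<open>x - y \<in> S\<^sup>\<bottom>\<close>
  show "orth_proj S x \<in> S" "x - orth_proj S x \<in> S\<^sup>\<bottom>" by auto
qed

lemma linear_orth_proj:
  assumes S: "subspace S"
  shows "linear (orth_proj S)"
proof (rule linearI)
  fix x y
  have "(x - orth_proj S x) + (y - orth_proj S y) \<in> S\<^sup>\<bottom>"
    using orth_proj_in[OF S] subspace_orthogonal_comp subspace_add by blast
  thus "orth_proj S (x + y) = orth_proj S x + orth_proj S y"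
    by (intro orth_proj_unique[OF S])
       (auto simp: orth_proj_in[OF S] subspace_add[OF S] algebra_simps)
next
  fix c x
  have "c *\<^sub>R (x - orth_proj S x) \<in> S\<^sup>\<bottom>"
    using orth_proj_in[OF S] subspace_orthogonal_comp subspace_scale by blast
  thus "orth_proj S (c *\<^sub>R x) = c *\<^sub>R orth_proj S x"
    by (intro orth_proj_unique[OF S])
       (auto simp: orth_proj_in[OF S] subspace_scale[OF S] algebra_simps)
qed

lemma subspace_direction [simp]: "subspace (direction V)"
  by (simp add: direction_def)

lemma direction_translation:
  assumes "subspace S"
  shows "direction ((+) a ` S) = S"
proof -
  have "{x - y |x y. x \<in> (+) a ` S \<and> y \<in> (+) a ` S} = S"
  proof (intro equalityI subsetI)
    fix z assume "z \<in> S"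
    hence "z = (a + z) - (a + 0)" "a + z \<in> (+) a ` S" "a + 0 \<in> (+) a ` S"
      using subspace_0[OF assms] by auto
    thus "z \<in> {x - y |x y. x \<in> (+) a ` S \<and> y \<in> (+) a ` S}" by blast
  qed (use assms in \<open>auto simp: subspace_diff\<close>)
  thus ?thesis using assms by (simp add: direction_def span_eq_iff)
qed

lemma offset_translation:
  assumes S: "subspace S" and a: "a \<in> S\<^sup>\<bottom>"
  shows "offset ((+) a ` S) = a"
  unfolding offset_def direction_translation[OF S]
proof (rule the_equality)
  show "a \<in> (+) a ` S \<and> a \<in> S\<^sup>\<bottom>" using a subspace_0[OF S] by (auto simp: image_iff)
  fix b assume b: "b \<in> (+) a ` S \<and> b \<in> S\<^sup>\<bottom>"
  hence "b - a \<in> S" by auto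
  moreover have "b - a \<in> S\<^sup>\<bottom>" using a b subspace_orthogonal_comp subspace_diff by blast
  ultimately have "orthogonal (b - a) (b - a)" by (auto simp: orthogonal_comp_def)
  thus "b = a" by (simp add: orthogonal_self)
qed

lemma hyperplane_decomposition:
  fixes V :: "'a::euclidean_space set"
  assumes "V \<in> hyperplanes"
  shows "dim (direction V) = DIM('a) - 1"
    and "offset V \<in> (direction V)\<^sup>\<bottom>"
    and "V = (+) (offset V) ` direction V"
proof -
  have aff: "affine V" and ad: "aff_dim V = int DIM('a) - 1"
    using assms by (auto simp: hyperplanes_def)
  have "V \<noteq> {}" using ad DIM_positive[where 'a='a] by auto
  then obtain b where b: "b \<in> V" by blast
  define S where "S = (\<lambda>x. x - b) ` V"
  have S: "subspace S" unfolding S_def using affine_diffs_subspace_subtract aff b by blast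
  define a where "a = b - orth_proj S b"
  have a: "a \<in> S\<^sup>\<bottom>" unfolding a_def by (rule orth_proj_in[OF S])
  have pb: "orth_proj S b \<in> S" by (rule orth_proj_in[OF S])
  have V: "V = (+) a ` S"
  proof (intro equalityI subsetI)
    fix x assume "x \<in> V"
    hence "x - b \<in> S" by (auto simp: S_def)
    hence "x - b + orth_proj S b \<in> S" using pb S by (simp add: subspace_add)
    moreover have "x = a + (x - b + orth_proj S b)" by (simp add: a_def)
    ultimately show "x \<in> (+) a ` S" by blast
  next
    fix x assume "x \<in> (+) a ` S"
    then obtain z where z: "z \<in> S" "x = a + z" by blast
    hence "z - orth_proj S b \<in> S" using pb S by (simp add: subspace_diff)
    thus "x \<in> V" using z by (auto simp: S_def a_def algebra_simps)
  qed
  have dir: "direction V = S" and off: "offset V = a"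
    using direction_translation[OF S] offset_translation[OF S a] V by auto
  show "offset V \<in> (direction V)\<^sup>\<bottom>" "V = (+) (offset V) ` direction V"
    using a V dir off by auto
  have "int (dim S) = aff_dim V"
    using V aff_dim_translation_eq[of a S] aff_dim_subspace[OF S] by simp
  thus "dim (direction V) = DIM('a) - 1" using ad dir by simp
qed

lemma bounded_linear_orth_proj_diff:
  "bounded_linear (\<lambda>x. orth_proj (direction V) x - orth_proj (direction W) x)"
  by (intro bounded_linear_sub linear_conv_bounded_linear[THEN iffD1] linear_orth_proj) simp_all

lemma orth_proj_range:
  assumes "subspace S"
  shows "range (orth_proj S) = S"
proof (intro equalityI subsetI)
  fix x assume "x \<in> S"
  hence "orth_proj S x = x"
    using assms subspace_0[OF subspace_orthogonal_comp] by (intro orth_proj_unique) auto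
  thus "x \<in> range (orth_proj S)" by (metis rangeI)
qed (use orth_proj_in[OF assms] in auto)

theorem Metric_space_hyperplanes: "Metric_space hyperplanes hyperplane_dist"
proof
  fix V W U :: "'a set"
  show "0 \<le> hyperplane_dist V W"
    by (simp add: hyperplane_dist_def onorm_pos_le[OF bounded_linear_orth_proj_diff])
  have "onorm (\<lambda>x. orth_proj (direction V) x - orth_proj (direction W) x)
      = onorm (\<lambda>x. - (orth_proj (direction W) x - orth_proj (direction V) x))"
    by simp
  also have "\<dots> = onorm (\<lambda>x. orth_proj (direction W) x - orth_proj (direction V) x)"
    by (rule onorm_neg)
  finally show "hyperplane_dist V W = hyperplane_dist W V"
    by (simp add: hyperplane_dist_def norm_minus_commute)
  have "onorm (\<lambda>x. orth_proj (direction V) x - orth_proj (direction U) x)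
      = onorm (\<lambda>x. (orth_proj (direction V) x - orth_proj (direction W) x)
                 + (orth_proj (direction W) x - orth_proj (direction U) x))"
    by simp
  also have "\<dots> \<le> onorm (\<lambda>x. orth_proj (direction V) x - orth_proj (direction W) x)
                + onorm (\<lambda>x. orth_proj (direction W) x - orth_proj (direction U) x)"
    by (rule onorm_triangle[OF bounded_linear_orth_proj_diff bounded_linear_orth_proj_diff])
  finally show "hyperplane_dist V U \<le> hyperplane_dist V W + hyperplane_dist W U"
    using norm_triangle_ineq[of "offset V - offset W" "offset W - offset U"]
    by (simp add: hyperplane_dist_def)
  assume VW: "V \<in> hyperplanes" "W \<in> hyperplanes"
  show "hyperplane_dist V W = 0 \<longleftrightarrow> V = W"
  proof
    assume "hyperplane_dist V W = 0"
    hence *: "onorm (\<lambda>x. orth_proj (direction V) x - orth_proj (direction W) x) = 0"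
      and off: "offset V = offset W"
      using onorm_pos_le[OF bounded_linear_orth_proj_diff, of V W]
        norm_ge_zero[of "offset V - offset W"]
      unfolding hyperplane_dist_def by (linarith, simp add: add_nonneg_eq_0_iff)
    have "orth_proj (direction V) = orth_proj (direction W)"
      using * onorm_eq_0[OF bounded_linear_orth_proj_diff, of V W] by auto
    hence "direction V = direction W"
      using orth_proj_range[OF subspace_direction] by metis
    thus "V = W" using off hyperplane_decomposition(3) VW by metis
  qed (simp add: hyperplane_dist_def onorm_zero)
qed

end

(* Write V as x_i = c + sum_j m_j x_j for a coordinate i with the largest normal component, and let
   u(p, V) be the scaled defect of a point p in this equation. With q = exp(-delta), the nonnegative
   kernel Re (1 / (1 - q e^{iu})) = Re (sum_n q^n e^{inu}) is at least const / delta on incidences, so it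
   suffices to bound its sum over P x H by const |P| |H|. For each n >= 1 the phase e^{-inmx} is, up to the
   factor e^{-m^2/2}, the inner product in L^2(R) of a Gaussian centred at x and a weighted plane wave
   of frequency nm. Hence 2 Re sum e^{inu} is at most the sum of two Gram forms, with kernels of size
   n^{(d-1)/2} e^{-n^2 r^2 / 4} in the distances r among the points and among the planes. Summed over
   n, each of these kernels is O(max(delta, dist)^{-(d+1)/2}), and such an energy is O(|P|^2),
   resp. O(|H|^2), because s, t > (d+1)/2. *)
theory Submission
  imports Defs "HOL-Probability.Probability"
begin

section \<open>Gram bounds from Gaussian integrals\<close>

text \<open>The obstacle is that a Gram kernel decays only in the coordinates other than i; in
  coordinate i it merely oscillates, as cos(n (w_p - w_q)). Absolute values taken for each n would
  lose the decay in w, which comes from cancellation between different n. The way out is that each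
  Gram form is nonnegative for each n. Its coefficient, about n^{(d-1)/2}, can then be enlarged to a
  multiple of the Taylor coefficient of (1 - z)^{-beta}, beta = (d+1)/2, before anything is summed.
  The sum over n becomes an average of values of this function, of the size of a distance to the
  singularity z = 1 to the power -beta: the modulus of z sees delta and the Gaussian decay, the
  argument sees w. Coordinate i contributes phases alone, so the power of n counts d - 1
  coordinates; this fixes beta and with it the threshold for s and t. The defect is scaled so that
  all differences of w lie in [-1, 1] and the argument cannot wrap around to the singularity again.
  The kernel is half of one plus the Poisson kernel of the disc; being nonnegative, it lets pairs
  that are not incident be dropped.\<close>

lemma gaussian_fourier:
  assumes \<sigma>: "\<sigma> > 0"
  shows "has_bochner_integral lborel
    (\<lambda>z. of_real (normal_density \<mu> \<sigma> z) * cis (t * z)) (cis (t * \<mu>) * of_real (exp (- (\<sigma> * t)\<^sup>2 / 2)))"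
proof -
  define f where "f = (\<lambda>s z. of_real (std_normal_density z) * cis (s * z) :: complex)"
  have int: "integrable lborel (f s)" for s
    by (rule Bochner_Integration.integrable_bound[of _ std_normal_density])
      (auto simp: f_def norm_mult cis_conv_exp intro!: borel_measurable_times)
  have val: "integral\<^sup>L lborel (f s) = of_real (exp (- s\<^sup>2 / 2))" for s
  proof -
    have "char std_normal_distribution s = of_real (exp (- s\<^sup>2 / 2))"
      using char_std_normal_distribution by (simp add: fun_eq_iff)
    also have "char std_normal_distribution s = integral\<^sup>L lborel (f s)"
      unfolding char_def f_def cis_conv_exp
      by (subst integral_density) (auto simp: scaleR_conv_of_real)
    finally show ?thesis by simp
  qed
  have "has_bochner_integral lborel (\<lambda>z. of_real (normal_density \<mu> \<sigma> z) * cis (t * z))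
          (cis (t * \<mu>) * of_real (exp (- (\<sigma> * t)\<^sup>2 / 2))) \<longleftrightarrow>
    has_bochner_integral lborel (\<lambda>x. of_real (normal_density \<mu> \<sigma> (\<mu> + \<sigma> * x)) * cis (t * (\<mu> + \<sigma> * x)))
          ((cis (t * \<mu>) * of_real (exp (- (\<sigma> * t)\<^sup>2 / 2))) /\<^sub>R \<bar>\<sigma>\<bar>)"
    by (rule lborel_has_bochner_integral_real_affine_iff) (use \<sigma> in simp)
  also have "(\<lambda>x. of_real (normal_density \<mu> \<sigma> (\<mu> + \<sigma> * x)) * cis (t * (\<mu> + \<sigma> * x)))
     = (\<lambda>x. (cis (t * \<mu>) /\<^sub>R \<sigma>) * f (\<sigma> * t) x)"
  proof
    fix x
    have "normal_density \<mu> \<sigma> (\<mu> + \<sigma> * x) = std_normal_density x / \<sigma>"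
      using \<sigma> by (simp add: normal_density_def power_mult_distrib real_sqrt_mult)
    moreover have "cis (t * (\<mu> + \<sigma> * x)) = cis (t * \<mu>) * cis (\<sigma> * t * x)"
      by (simp add: cis_mult algebra_simps)
    ultimately show "of_real (normal_density \<mu> \<sigma> (\<mu> + \<sigma> * x)) * cis (t * (\<mu> + \<sigma> * x))
      = (cis (t * \<mu>) /\<^sub>R \<sigma>) * f (\<sigma> * t) x"
      by (simp add: f_def scaleR_conv_of_real field_simps)
  qed
  finally show ?thesis
    using has_bochner_integral_mult_right[OF has_bochner_integral_integrable[OF int[of "\<sigma> * t"]],
        of "cis (t * \<mu>) /\<^sub>R \<sigma>"] \<sigma>
    by (simp add: val scaleR_conv_of_real mult_ac)
qed

text \<open>Unnormalised form: \<open>f\<close> only has to agree pointwise with a Gaussian times a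
  phase, so each Gram integral below reduces to completing a square. Frequency 0 gives the total
  mass.\<close>

lemma gaussian_fourier':
  assumes \<sigma>: "\<sigma> > 0"
    and f: "\<And>z. f z = of_real (A * exp (- (z - \<mu>)\<^sup>2 / (2 * \<sigma>\<^sup>2))) * cis (t * z)"
  shows "has_bochner_integral lborel f
    (of_real (A * sqrt (2 * pi) * \<sigma> * exp (- (\<sigma> * t)\<^sup>2 / 2)) * cis (t * \<mu>))"
proof -
  have "f = (\<lambda>z. of_real (A * sqrt (2 * pi) * \<sigma>) * (of_real (normal_density \<mu> \<sigma> z) * cis (t * z)))"
  proof
    fix z
    show "f z = of_real (A * sqrt (2 * pi) * \<sigma>) * (of_real (normal_density \<mu> \<sigma> z) * cis (t * z))"
      using \<sigma> by (simp add: f normal_density_def real_sqrt_mult field_simps)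
  qed
  thus ?thesis
    using has_bochner_integral_mult_right[OF gaussian_fourier[OF \<sigma>],
        of "of_real (A * sqrt (2 * pi) * \<sigma>)" \<mu> t]
    by (simp add: mult_ac)
qed

lemma has_bochner_integral_mono_real:
  fixes f g :: "'a \<Rightarrow> real"
  assumes "has_bochner_integral M f x" "has_bochner_integral M g y" "\<And>z. f z \<le> g z"
  shows "x \<le> y"
  using integral_mono[of M f g] assms
  by (auto simp: has_bochner_integral_iff)

section \<open>Positive forms and their stability under products\<close>

text \<open>Up to conjugation this is positivity of the block form with diagonal blocks
  \<open>A\<close>, \<open>B\<close> and off-diagonal block \<open>-F\<close>. It is demanded for
  all weights because a further kernel factor is multiplied in by absorbing it into \<open>u\<close>
  and \<open>v\<close>.\<close>

definition gram_dominated ::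
  "'a set \<Rightarrow> 'b set \<Rightarrow> ('a \<Rightarrow> 'a \<Rightarrow> complex) \<Rightarrow> ('a \<Rightarrow> 'b \<Rightarrow> complex) \<Rightarrow> ('b \<Rightarrow> 'b \<Rightarrow> complex) \<Rightarrow> bool"
  where "gram_dominated X Y A F B \<longleftrightarrow> (\<forall>u v.
    2 * Re (\<Sum>x\<in>X. \<Sum>y\<in>Y. u x * v y * F x y)
      \<le> Re (\<Sum>x\<in>X. \<Sum>x'\<in>X. u x * cnj (u x') * A x x') + Re (\<Sum>y\<in>Y. \<Sum>y'\<in>Y. v y * cnj (v y') * B y y'))"

lemma gram_dominated_one: "gram_dominated X Y (\<lambda>_ _. 1) (\<lambda>_ _. 1) (\<lambda>_ _. 1)"
proof -
  have "2 * Re (\<Sum>x\<in>X. \<Sum>y\<in>Y. u x * v y) \<le> Re (\<Sum>x\<in>X. \<Sum>x'\<in>X. u x * cnj (u x')) + Re (\<Sum>y\<in>Y. \<Sum>y'\<in>Y. v y * cnj (v y'))"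
    for u v
  proof -
    define U V where "U = sum u X" and "V = sum v Y"
    have "(\<Sum>x\<in>X. \<Sum>y\<in>Y. u x * v y) = U * V"
      by (simp add: U_def V_def sum_product)
    moreover have "(\<Sum>x\<in>X. \<Sum>x'\<in>X. u x * cnj (u x')) = U * cnj U" "(\<Sum>y\<in>Y. \<Sum>y'\<in>Y. v y * cnj (v y')) = V * cnj V"
      by (simp_all add: U_def V_def sum_product)
    \<comment> \<open>This is |U - cnj V|^2 \<ge> 0.\<close>
    moreover have "2 * Re (U * V) \<le> Re (U * cnj U) + Re (V * cnj V)"
      using sum_squares_ge_zero[of "Re U - Re V" "Im U + Im V"] by (simp add: algebra_simps)
    ultimately show ?thesis by simp
  qed
  thus ?thesis by (simp add: gram_dominated_def)
qed

text \<open>A Schur product argument: for fixed \<open>z\<close> the hypothesis is applied to the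
  weights \<open>u x * a x z\<close> and \<open>v y * b y z\<close>, and the inequality is
  integrated in \<open>z\<close>. It lets the coordinates be treated one after another.\<close>

lemma gram_dominated_integral:
  assumes G: "gram_dominated X Y A F B"
    and f: "\<And>x y. x \<in> X \<Longrightarrow> y \<in> Y \<Longrightarrow> has_bochner_integral M (\<lambda>z. a x z * b y z) (f x y)"
    and \<alpha>: "\<And>x x'. x \<in> X \<Longrightarrow> x' \<in> X \<Longrightarrow> has_bochner_integral M (\<lambda>z. a x z * cnj (a x' z)) (\<alpha> x x')"
    and \<gamma>: "\<And>y y'. y \<in> Y \<Longrightarrow> y' \<in> Y \<Longrightarrow> has_bochner_integral M (\<lambda>z. b y z * cnj (b y' z)) (\<gamma> y y')"
  shows "gram_dominated X Y (\<lambda>x x'. A x x' * \<alpha> x x') (\<lambda>x y. F x y * f x y) (\<lambda>y y'. B y y' * \<gamma> y y')"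
  unfolding gram_dominated_def
proof (intro allI)
  fix u v
  have 1: "has_bochner_integral M (\<lambda>z. 2 * Re (\<Sum>x\<in>X. \<Sum>y\<in>Y. (u x * v y * F x y) * (a x z * b y z)))
     (2 * Re (\<Sum>x\<in>X. \<Sum>y\<in>Y. (u x * v y * F x y) * f x y))"
    by (intro has_bochner_integral_mult_right has_bochner_integral_Re has_bochner_integral_sum f)
  have 2: "has_bochner_integral M (\<lambda>z. Re (\<Sum>x\<in>X. \<Sum>x'\<in>X. (u x * cnj (u x') * A x x') * (a x z * cnj (a x' z))))
     (Re (\<Sum>x\<in>X. \<Sum>x'\<in>X. (u x * cnj (u x') * A x x') * \<alpha> x x'))"
    by (intro has_bochner_integral_mult_right has_bochner_integral_Re has_bochner_integral_sum \<alpha>)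
  have 3: "has_bochner_integral M (\<lambda>z. Re (\<Sum>x\<in>Y. \<Sum>x'\<in>Y. (v x * cnj (v x') * B x x') * (b x z * cnj (b x' z))))
     (Re (\<Sum>x\<in>Y. \<Sum>x'\<in>Y. (v x * cnj (v x') * B x x') * \<gamma> x x'))"
    by (intro has_bochner_integral_mult_right has_bochner_integral_Re has_bochner_integral_sum \<gamma>)
  have "2 * Re (\<Sum>x\<in>X. \<Sum>y\<in>Y. (u x * v y * F x y) * f x y) \<le>
    Re (\<Sum>x\<in>X. \<Sum>x'\<in>X. (u x * cnj (u x') * A x x') * \<alpha> x x') +
    Re (\<Sum>x\<in>Y. \<Sum>x'\<in>Y. (v x * cnj (v x') * B x x') * \<gamma> x x')"
  proof (rule has_bochner_integral_mono_real[OF 1 has_bochner_integral_add[OF 2 3]])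
    fix z
    show "2 * Re (\<Sum>x\<in>X. \<Sum>y\<in>Y. (u x * v y * F x y) * (a x z * b y z))
      \<le> Re (\<Sum>x\<in>X. \<Sum>x'\<in>X. (u x * cnj (u x') * A x x') * (a x z * cnj (a x' z)))
        + Re (\<Sum>x\<in>Y. \<Sum>x'\<in>Y. (v x * cnj (v x') * B x x') * (b x z * cnj (b x' z)))"
      using G[unfolded gram_dominated_def, rule_format, of "\<lambda>x. u x * a x z" "\<lambda>y. v y * b y z"]
      by (simp add: mult_ac)
  qed
  thus "2 * Re (\<Sum>x\<in>X. \<Sum>y\<in>Y. u x * v y * (F x y * f x y)) \<le>
    Re (\<Sum>x\<in>X. \<Sum>x'\<in>X. u x * cnj (u x') * (A x x' * \<alpha> x x')) +
    Re (\<Sum>x\<in>Y. \<Sum>x'\<in>Y. v x * cnj (v x') * (B x x' * \<gamma> x x'))"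
    by (simp add: mult_ac)
qed

lemma gaussian_gram_step:
  fixes x :: "'a \<Rightarrow> real" and m :: "'b \<Rightarrow> real"
  assumes G: "gram_dominated X Y A F B" and N: "N > 0"
  defines "c \<equiv> sqrt ((1 + N\<^sup>2) / 2) / sqrt N"
  shows "gram_dominated X Y
     (\<lambda>p q. A p q * of_real (c * exp (- (N * (x p - x q))\<^sup>2 / 4) * exp ((x p + x q)\<^sup>2 / 4)))
     (\<lambda>p h. F p h * (cis (- (N * m h * x p)) * of_real (exp (- (m h)\<^sup>2 / 2))))
     (\<lambda>g h. B g h * of_real (c * exp (- (N * (m g - m h))\<^sup>2 / 4) * exp (- (m g - m h)\<^sup>2 / 4)))"
proof (rule gram_dominated_integral[OF G, where M = lborel])
  \<comment> \<open>The weight \<open>exp (\<plusminus> \<kappa> z\<^sup>2 / 2)\<close> makes the plane wave \<open>b\<close> square integrable. This value of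
    \<open>\<kappa>\<close> leaves the remaining factors of both Gram kernels independent of \<open>N\<close>.\<close>
  define \<kappa> where "\<kappa> = N\<^sup>2 / (1 + N\<^sup>2)"
  define s where "s = 1 + N\<^sup>2"
  have s: "s > 1" using N by (simp add: s_def)
  \<comment> \<open>Moving a factor \<open>sqrt S\<close> from \<open>a\<close> to \<open>b\<close>
    leaves their product unchanged; the value \<open>sqrt N\<close> of \<open>S\<close> gives both
    Gram kernels the same constant \<open>c\<close>.\<close>
  define S where "S = sqrt N"
  have S: "S > 0" "S\<^sup>2 = N" using N by (auto simp: S_def)
  define R where "R = sqrt (2 * pi)"
  have R: "R > 0" "R\<^sup>2 = 2 * pi" using N by (auto simp: R_def)
  define a where "a = (\<lambda>p z. of_real (N / sqrt R / sqrt S * exp (- (N * (z - x p))\<^sup>2 / 2 + \<kappa> * z\<^sup>2 / 2)) :: complex)"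
  define b where "b = (\<lambda>h z. of_real (sqrt S / sqrt R * exp (- (\<kappa> * z\<^sup>2 / 2))) * cis (- N * m h * z))"
  fix p q g h
  show "has_bochner_integral lborel (\<lambda>z. a p z * b h z)
      (cis (- (N * m h * x p)) * of_real (exp (- (m h)\<^sup>2 / 2)))"
  proof -
    have "has_bochner_integral lborel (\<lambda>z. a p z * b h z)
      (of_real (N / R * sqrt (2 * pi) * (1 / N) * exp (- ((1 / N) * (- N * m h))\<^sup>2 / 2)) * cis ((- N * m h) * x p))"
    proof (rule gaussian_fourier')
      fix z
      have "a p z * b h z = of_real (N / (sqrt R * sqrt R) * (exp (- (N * (z - x p))\<^sup>2 / 2 + \<kappa> * z\<^sup>2 / 2) * exp (- (\<kappa> * z\<^sup>2 / 2)))) * cis (- N * m h * z)"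
        using S by (simp add: a_def b_def mult_ac del: real_sqrt_mult_self real_sqrt_abs2)
      also have "\<dots> = of_real (N / R * exp (- (z - x p)\<^sup>2 / (2 * (1 / N)\<^sup>2))) * cis (- N * m h * z)"
        using N R unfolding exp_add[symmetric] by (simp add: power2_eq_square field_simps)
      finally show "a p z * b h z = of_real (N / R * exp (- (z - x p)\<^sup>2 / (2 * (1 / N)\<^sup>2))) * cis (- N * m h * z)" .
    qed (use N in simp)
    thus ?thesis using N R by (simp add: R_def mult.commute)
  qed
  have K: "R * (sqrt (s / 2) / N\<^sup>2) * (N\<^sup>2 / (R * S)) = c"
    using N R S by (simp add: c_def s_def S_def field_simps)
  show "has_bochner_integral lborel (\<lambda>z. a p z * cnj (a q z))
      (of_real (c * exp (- (N * (x p - x q))\<^sup>2 / 4) * exp ((x p + x q)\<^sup>2 / 4)))"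
  proof -
    define E where "E = exp (- (N * (x p - x q))\<^sup>2 / 4) * exp ((x p + x q)\<^sup>2 / 4)"
    \<comment> \<open>Completing the square: the weight lowers the coefficient of - z^2 from N^2 to
      N^2 - \<kappa> = N^4 / s, hence 2 \<sigma>^2 = s / N^4.\<close>
    define \<mu> where "\<mu> = (x p + x q) / 2 * s / N\<^sup>2"
    define \<sigma> where "\<sigma> = sqrt (s / 2) / N\<^sup>2"
    have 1: "has_bochner_integral lborel (\<lambda>z. a p z * cnj (a q z))
      (of_real (N\<^sup>2 / (R * S) * E * sqrt (2 * pi) * \<sigma> * exp (- (\<sigma> * 0)\<^sup>2 / 2)) * cis (0 * \<mu>))"
    proof (rule gaussian_fourier')
      fix z
      have "a p z * cnj (a q z) = of_real ((N * N) / (sqrt R * sqrt R * (sqrt S * sqrt S)) *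
         (exp (- (N * (z - x p))\<^sup>2 / 2 + \<kappa> * z\<^sup>2 / 2) * exp (- (N * (z - x q))\<^sup>2 / 2 + \<kappa> * z\<^sup>2 / 2)))"
        by (simp add: a_def mult_ac del: real_sqrt_mult_self real_sqrt_abs2)
      also have "sqrt R * sqrt R = R" using R by simp
      also have "sqrt S * sqrt S = S" using S by simp
      also have "exp (- (N * (z - x p))\<^sup>2 / 2 + \<kappa> * z\<^sup>2 / 2) * exp (- (N * (z - x q))\<^sup>2 / 2 + \<kappa> * z\<^sup>2 / 2)
        = E * exp (- (z - \<mu>)\<^sup>2 / (2 * \<sigma>\<^sup>2))"
      proof -
        have "2 * \<sigma>\<^sup>2 = s / (N ^ 4)"
          using s N by (simp add: \<sigma>_def power_divide flip: power_mult)
        hence "(z - \<mu>)\<^sup>2 / (2 * \<sigma>\<^sup>2) = (N * N * z - (x p + x q) / 2 * s)\<^sup>2 / s"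
          using s N by (simp add: \<mu>_def power2_eq_square power4_eq_xxxx field_simps)
        moreover have "- (N * (z - x p))\<^sup>2 / 2 + \<kappa> * z\<^sup>2 / 2 + (- (N * (z - x q))\<^sup>2 / 2 + \<kappa> * z\<^sup>2 / 2)
          = - (N * (x p - x q))\<^sup>2 / 4 + (x p + x q)\<^sup>2 / 4 + - ((N * N * z - (x p + x q) / 2 * s)\<^sup>2 / s)"
        proof -
          have "\<kappa> = (s - 1) / s" by (simp add: \<kappa>_def s_def)
          hence "\<kappa> = 1 - 1 / s" using s by (simp add: diff_divide_distrib)
          moreover have "((N * N * z - (x p + x q) / 2 * s)\<^sup>2 / s) = ((s - 1)\<^sup>2 / s) * z\<^sup>2 - (s - 1) * z * (x p + x q) + (x p + x q)\<^sup>2 / 4 * s"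
            using s by (simp add: s_def power2_eq_square field_simps)
          moreover have "(s - 1)\<^sup>2 / s = s - 2 + 1 / s"
            using s by (simp add: power2_eq_square field_simps)
          moreover have "N\<^sup>2 = s - 1" by (simp add: s_def)
          ultimately show ?thesis
            unfolding power_mult_distrib by (simp only:) (simp add: power2_eq_square field_simps)
        qed
        ultimately show ?thesis unfolding E_def exp_add[symmetric] by simp
      qed
      finally show "a p z * cnj (a q z) = of_real (N\<^sup>2 / (R * S) * E * exp (- (z - \<mu>)\<^sup>2 / (2 * \<sigma>\<^sup>2))) * cis (0 * z)"
        by (simp add: power2_eq_square mult_ac)
    qed (use N s in \<open>simp add: \<sigma>_def\<close>)
    have 2: "N\<^sup>2 / (R * S) * E * sqrt (2 * pi) * \<sigma> = c * E"
      unfolding K[symmetric] \<sigma>_def R_def by (simp only: mult_ac)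
    from 1[unfolded 2] show ?thesis by (simp add: E_def mult.assoc)
  qed
  show "has_bochner_integral lborel (\<lambda>z. b g z * cnj (b h z))
      (of_real (c * exp (- (N * (m g - m h))\<^sup>2 / 4) * exp (- (m g - m h)\<^sup>2 / 4)))"
  proof -
    define \<sigma> where "\<sigma> = sqrt (s / 2) / N"
    define T where "T = - N * (m g - m h)"
    have \<sigma>2: "\<sigma>\<^sup>2 = s / (2 * N\<^sup>2)" using s N by (simp add: \<sigma>_def power_divide)
    have 1: "has_bochner_integral lborel (\<lambda>z. b g z * cnj (b h z))
      (of_real (S / R * sqrt (2 * pi) * \<sigma> * exp (- (\<sigma> * T)\<^sup>2 / 2)) * cis (T * 0))"
    proof (rule gaussian_fourier')
      fix z
      have "b g z * cnj (b h z) = of_real ((sqrt S * sqrt S) / (sqrt R * sqrt R) *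
         (exp (- (\<kappa> * z\<^sup>2 / 2)) * exp (- (\<kappa> * z\<^sup>2 / 2)))) * (cis (- N * m g * z) * cis (- (- N * m h * z)))"
        by (simp add: b_def cis_cnj mult_ac del: real_sqrt_mult_self real_sqrt_abs2 cis_mult)
      also have "sqrt R * sqrt R = R" using R by simp
      also have "sqrt S * sqrt S = S" using S by simp
      also have "cis (- N * m g * z) * cis (- (- N * m h * z)) = cis (T * z)"
        by (simp add: cis_mult T_def algebra_simps)
      also have "exp (- (\<kappa> * z\<^sup>2 / 2)) * exp (- (\<kappa> * z\<^sup>2 / 2)) = exp (- (z - 0)\<^sup>2 / (2 * \<sigma>\<^sup>2))"
        using N s unfolding exp_add[symmetric] \<sigma>2 \<kappa>_def s_def[symmetric]
          by (simp add: field_simps)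
      finally show "b g z * cnj (b h z) = of_real (S / R * exp (- (z - 0)\<^sup>2 / (2 * \<sigma>\<^sup>2))) * cis (T * z)" .
    qed (use N s in \<open>simp add: \<sigma>_def\<close>)
    have 2: "S / R * sqrt (2 * pi) * \<sigma> = c"
    proof -
      have "S / R * sqrt (2 * pi) * \<sigma> = S * \<sigma>" using R by (simp add: R_def)
      also have "\<dots> = c" using S N unfolding c_def \<sigma>_def s_def S_def[symmetric]
        by (simp add: field_simps power2_eq_square)
      finally show ?thesis .
    qed
    \<comment> \<open>Here \<sigma>^2 T^2 = (1 + N^2) (m g - m h)^2 / 2, and the summand 1 yields
      the factor independent of N.\<close>
    have 3: "exp (- (\<sigma> * T)\<^sup>2 / 2) = exp (- (N * (m g - m h))\<^sup>2 / 4) * exp (- (m g - m h)\<^sup>2 / 4)"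
      unfolding exp_add[symmetric] power_mult_distrib \<sigma>2 T_def s_def using N
      by (simp add: power_mult_distrib field_simps)
    from 1[unfolded 2 3] show ?thesis by (simp add: mult.assoc)
  qed
qed

section \<open>Binomial series with Gaussian damping\<close>

text \<open>The linear Taylor term has error at most |x|^3 / 6, which is at most 3/8 of |x| on this
  range. The endpoint 3/2 is what a phase |w| \<le> 1 can reach after a perturbation of at most half
  its size.\<close>

lemma abs_sin_ge_half:
  fixes x :: real
  assumes "\<bar>x\<bar> \<le> 3 / 2"
  shows "\<bar>x\<bar> / 2 \<le> \<bar>sin x\<bar>"
proof -
  have "\<bar>sin x - (\<Sum>m<3. sin_coeff m * x ^ m)\<bar> \<le> inverse (fact 3) * \<bar>x\<bar> ^ 3"
    by (rule Maclaurin_sin_bound)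
  hence "\<bar>sin x - x\<bar> \<le> \<bar>x\<bar> ^ 3 / 6"
    by (simp add: numeral_3_eq_3 sin_coeff_def fact_numeral)
  moreover have "\<bar>x\<bar> ^ 3 = \<bar>x\<bar> * \<bar>x\<bar>\<^sup>2" by (simp add: power3_eq_cube power2_eq_square)
  moreover have "\<bar>x\<bar>\<^sup>2 \<le> (3/2)\<^sup>2" using assms by (intro power_mono) auto
  hence "\<bar>x\<bar> * \<bar>x\<bar>\<^sup>2 \<le> \<bar>x\<bar> * (9/4)" by (intro mult_left_mono) (auto simp: power2_eq_square)
  ultimately show ?thesis by linarith
qed

text \<open>The distance to the singularity 1 sees \<delta> + r through the modulus. It sees |w|
  through the argument, unless the shift \<open>r * \<xi> / sqrt 2\<close> exceeds half of |w|; then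
  |w| \<le> 2 r |\<xi>| is already controlled by r. This second case is the source of the factor 1 +
  |\<xi>|.\<close>

lemma max_le_norm_one_minus_polar:
  fixes \<delta> w r \<xi> :: real
  assumes \<delta>: "0 < \<delta>" "\<delta> \<le> 1" and w: "\<bar>w\<bar> \<le> 1" and r: "0 \<le> r" "r \<le> 2"
  shows "max \<delta> (max \<bar>w\<bar> r)
    \<le> 8 * (1 + \<bar>\<xi>\<bar>) * norm (1 - of_real (exp (- (\<delta> + r))) * cis (w + r * \<xi> / sqrt 2))"
proof -
  define q where "q = exp (- (\<delta> + r))"
  define \<theta> where "\<theta> = w + r * \<xi> / sqrt 2"
  define D where "D = norm (1 - of_real q * cis \<theta>)"
  have D0: "D \<ge> 0" by (simp add: D_def)
  have q: "0 < q" "q \<le> 1" using \<delta> r by (auto simp: q_def)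
  have "1 - q \<le> D"
    using norm_triangle_ineq2[of 1 "of_real q * cis \<theta>"] q by (simp add: D_def norm_mult)
  moreover have "(\<delta> + r) / 4 \<le> 1 - q"
  proof -
    define y where "y = \<delta> + r"
    have y: "0 < y" "y \<le> 3" using \<delta> r by (auto simp: y_def)
    have "inverse (exp y) \<le> inverse (1 + y)"
      using y by (intro le_imp_inverse_le exp_ge_add_one_self) auto
    hence "q \<le> inverse (1 + y)" unfolding q_def y_def by (simp only: exp_minus)
    moreover have "inverse (1 + y) \<le> 1 - y / 4"
    proof -
      have "0 \<le> y * (3 - y)" using y by (intro mult_nonneg_nonneg) auto
      hence "1 \<le> (1 - y / 4) * (1 + y)" by (simp add: algebra_simps)
      thus ?thesis using y by (simp add: inverse_eq_divide pos_divide_le_eq)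
    qed
    ultimately have "q \<le> 1 - y / 4" by (rule order_trans)
    thus ?thesis unfolding y_def by linarith
  qed
  ultimately have "(\<delta> + r) / 4 \<le> D" by (rule order_trans[rotated])
  hence 1: "\<delta> + r \<le> 4 * D" by (simp add: field_simps)
  have 2: "D \<ge> \<bar>sin \<theta>\<bar>"
  proof -
    \<comment> \<open>After the rotation \<open>q\<close> stands alone as a real number and drops
      out of the imaginary part.\<close>
    have "D = norm (cis (- \<theta>) * (1 - of_real q * cis \<theta>))" by (simp add: norm_mult D_def)
    also have "cis (- \<theta>) * (1 - of_real q * cis \<theta>) = cis (- \<theta>) - of_real q"
      by (simp add: algebra_simps cis_mult)
    also have "norm \<dots> \<ge> \<bar>Im (cis (- \<theta>) - of_real q)\<bar>" by (rule abs_Im_le_cmod)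
    finally show ?thesis by simp
  qed
  have "\<bar>w\<bar> \<le> 8 * (1 + \<bar>\<xi>\<bar>) * D"
  proof (cases "\<bar>r * \<xi> / sqrt 2\<bar> \<le> \<bar>w\<bar> / 2")
    case True
    have "\<bar>\<theta>\<bar> \<le> 3 / 2" "\<bar>w\<bar> / 2 \<le> \<bar>\<theta>\<bar>" using True w unfolding \<theta>_def by linarith+
    hence "\<bar>w\<bar> \<le> 4 * D" using 2 abs_sin_ge_half[of \<theta>] by linarith
    also have "\<dots> \<le> 8 * (1 + \<bar>\<xi>\<bar>) * D" using D0 by (intro mult_right_mono) auto
    finally show ?thesis .
  next
    case False
    have "\<bar>r * \<xi> / sqrt 2\<bar> = r * \<bar>\<xi>\<bar> / sqrt 2" using r by (simp add: abs_mult)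
    also have "\<dots> \<le> r * \<bar>\<xi>\<bar> / 1" using r by (intro divide_left_mono) auto
    finally have "\<bar>w\<bar> \<le> 2 * (r * \<bar>\<xi>\<bar>)" using False by linarith
    also have "r * \<bar>\<xi>\<bar> \<le> 4 * D * \<bar>\<xi>\<bar>" using 1 \<delta> by (intro mult_right_mono) auto
    finally show ?thesis using D0 by (simp add: algebra_simps)
  qed
  moreover have "4 * D \<le> 8 * (1 + \<bar>\<xi>\<bar>) * D" using D0 by (intro mult_right_mono) auto
  ultimately have "max \<delta> (max \<bar>w\<bar> r) \<le> 8 * (1 + \<bar>\<xi>\<bar>) * D"
    using 1 \<delta> r by (intro max.boundedI) linarith+
  thus ?thesis by (simp only: D_def q_def \<theta>_def)
qed

section \<open>The binomial series of (1 - z)^(-\<beta>)\<close>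

lemma binomial_series_sums:
  fixes z :: complex and \<beta> :: real
  assumes "norm z < 1"
  shows "(\<lambda>n. of_real (pochhammer \<beta> n / fact n) * z ^ n) sums ((1 - z) powr (- of_real \<beta>))"
proof -
  have "(\<lambda>n. ((- of_real \<beta>) gchoose n) * (- z) ^ n) sums (1 + (- z)) powr (- of_real \<beta>)"
    by (rule gen_binomial_complex) (use assms in simp)
  moreover have "((- of_real \<beta>) gchoose n) * (- z) ^ n = of_real (pochhammer \<beta> n / fact n) * z ^ n" for n
  proof -
    have "(- of_real \<beta>) gchoose n = (- 1) ^ n * (of_real (pochhammer \<beta> n / fact n) :: complex)"
      by (simp add: gbinomial_pochhammer pochhammer_of_real)
    moreover have "(- z) ^ n = (- 1) ^ n * z ^ n" by (rule power_minus)
    moreover have "(- 1) ^ n * (- 1) ^ n = (1::complex)" by (simp flip: power_mult_distrib)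
    ultimately show ?thesis by (simp add: mult_ac)
  qed
  ultimately show ?thesis by simp
qed

lemma binomial_series_summable:
  fixes q \<beta> :: real
  assumes "0 \<le> q" "q < 1" "0 \<le> \<beta>"
  shows "summable (\<lambda>n. pochhammer \<beta> n / fact n * q ^ n)"
proof -
  have "summable (\<lambda>n. of_real (pochhammer \<beta> n / fact n) * (of_real q) ^ n :: complex)"
    using binomial_series_sums[of "of_real q" \<beta>] assms by (auto simp: sums_iff)
  hence "summable (\<lambda>n. of_real (pochhammer \<beta> n / fact n * q ^ n) :: complex)" by simp
  thus ?thesis by (subst (asm) summable_of_real_iff)
qed

text \<open>The quotient of the power by the coefficient is Gauss's product for Gamma(\<beta>),
  which converges and is therefore bounded. This allows the growth n^(\<beta> - 1) of the Gram
  constants to be replaced by exact binomial coefficients.\<close>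

lemma powr_le_binomial_coeff:
  fixes \<beta> :: real
  assumes "\<beta> > 0"
  shows "\<exists>K>0. \<forall>n\<ge>1. real n powr (\<beta> - 1) \<le> K * (pochhammer \<beta> n / fact n)"
proof -
  have "\<beta> \<notin> \<int>\<^sub>\<le>\<^sub>0" using assms by (auto elim!: nonpos_Ints_cases)
  have "Bseq (Gamma_series' \<beta>)"
    using Gamma_series'_LIMSEQ[of \<beta>] by (blast intro: convergent_imp_Bseq convergentI)
  then obtain K where K: "K > 0" "\<And>n. norm (Gamma_series' \<beta> n) \<le> K" unfolding Bseq_def by blast
  have "real n powr (\<beta> - 1) \<le> K * (pochhammer \<beta> n / fact n)" if n: "n \<ge> 1" for n
  proof -
    have P: "pochhammer \<beta> n > 0" using assms by (rule pochhammer_pos)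
    have "fact (n - 1) * real n powr \<beta> / pochhammer \<beta> n \<le> K"
      using K(2)[of n] P n by (simp add: Gamma_series'_def powr_def)
    hence "fact (n - 1) * real n powr \<beta> \<le> K * pochhammer \<beta> n" using P by (simp add: field_simps)
    moreover have "fact n = real n * fact (n - 1)" using n fact_reduce[of n] by simp
    moreover have "real n powr \<beta> = real n powr (\<beta> - 1) * real n" using n by (simp add: powr_diff)
    ultimately show ?thesis using n by (simp add: field_simps)
  qed
  thus ?thesis using K by blast
qed

lemma integrable_std_normal_one_plus_abs_power:
  "integrable lborel (\<lambda>\<xi>. std_normal_density \<xi> * (1 + \<bar>\<xi>\<bar>) ^ b)"
proof -
  have "(\<lambda>\<xi>. std_normal_density \<xi> * (1 + \<bar>\<xi>\<bar>) ^ b)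
    = (\<lambda>\<xi>. \<Sum>k\<le>b. of_nat (b choose k) * (std_normal_density \<xi> * \<bar>\<xi>\<bar> ^ k))"
  proof
    fix \<xi> :: real
    have "(1 + \<bar>\<xi>\<bar>) ^ b = (\<Sum>k\<le>b. of_nat (b choose k) * \<bar>\<xi>\<bar> ^ k)"
      using binomial_ring[of "\<bar>\<xi>\<bar>" 1 b] by (simp add: add.commute)
    thus "std_normal_density \<xi> * (1 + \<bar>\<xi>\<bar>) ^ b = (\<Sum>k\<le>b. of_nat (b choose k) * (std_normal_density \<xi> * \<bar>\<xi>\<bar> ^ k))"
      by (simp add: sum_distrib_left mult_ac)
  qed
  thus ?thesis by (auto intro!: integrable_std_normal_moment_abs)
qed

lemma gaussian_binomial_series_bound:
  fixes \<beta> :: real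
  assumes \<beta>: "\<beta> > 0"
  shows "\<exists>K>0. \<forall>\<delta> w r. 0 < \<delta> \<and> \<delta> \<le> 1 \<and> \<bar>w\<bar> \<le> 1 \<and> 0 \<le> r \<and> r \<le> 2 \<longrightarrow>
    norm (\<Sum>n. of_real (pochhammer \<beta> n / fact n * exp (- \<delta>) ^ n * exp (- (real n * r)\<^sup>2 / 4)) * cis (real n * w))
      \<le> K * (max \<delta> (max \<bar>w\<bar> r)) powr (- \<beta>)"
proof -
  \<comment> \<open>An integer exponent above \<beta> makes the average over \<xi> a finite sum of
    moments of the normal law.\<close>
  define b where "b = nat \<lceil>\<beta>\<rceil>"
  define I where "I = (LINT \<xi>|lborel. std_normal_density \<xi> * (1 + \<bar>\<xi>\<bar>) ^ b)"
  have I: "I \<ge> 0" unfolding I_def by (intro integral_nonneg_AE) auto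
  \<comment> \<open>\<open>I + 1\<close> instead of \<open>I\<close>: only I \<ge> 0 is established,
    and \<open>K\<close> has to be positive.\<close>
  define K where "K = exp 1 * 8 powr \<beta> * (I + 1)"
  have "K > 0" using I by (simp add: K_def)
  moreover have "norm (\<Sum>n. of_real (pochhammer \<beta> n / fact n * exp (- \<delta>) ^ n * exp (- (real n * r)\<^sup>2 / 4)) * cis (real n * w))
      \<le> K * (max \<delta> (max \<bar>w\<bar> r)) powr (- \<beta>)"
    if \<delta>: "0 < \<delta>" "\<delta> \<le> 1" and w: "\<bar>w\<bar> \<le> 1" and r: "0 \<le> r" "r \<le> 2" for \<delta> w r
  proof -
    define M where "M = max \<delta> (max \<bar>w\<bar> r)"
    have M: "M > 0" using \<delta> by (simp add: M_def)
    define c where "c = (\<lambda>n. pochhammer \<beta> n / fact n)"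
    have c: "c n \<ge> 0" for n using \<beta> by (simp add: c_def pochhammer_nonneg)
    \<comment> \<open>The Gaussian \<open>exp (- (n r)\<^sup>2 / 4)\<close> is the average over a standard normal \<open>\<xi>\<close> of
      \<open>exp (1 - n r) cis ((n r - 2) \<xi> / sqrt 2)\<close>. The shift by 2 costs only a constant, but its factor
      \<open>exp (- n r)\<close> keeps the argument \<open>\<zeta>\<close> of the binomial series at distance of order \<open>r\<close> from
      the singularity at 1.\<close>
    define h where "h = (\<lambda>n::nat. of_real (c n * exp (- \<delta>) ^ n * exp (1 - real n * r)) * cis (real n * w))"
    define f where "f = (\<lambda>n \<xi>. h n * (of_real (normal_density 0 1 \<xi>) * cis ((real n * r - 2) / sqrt 2 * \<xi>)))"
    define \<zeta> where "\<zeta> = (\<lambda>\<xi>. of_real (exp (- (\<delta> + r))) * cis (w + r * \<xi> / sqrt 2))"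
    have f_int: "has_bochner_integral lborel (f n)
      (of_real (c n * exp (- \<delta>) ^ n * exp (- (real n * r)\<^sup>2 / 4)) * cis (real n * w))" for n
    proof -
      have "has_bochner_integral lborel (f n) (h n * (cis ((real n * r - 2) / sqrt 2 * 0) * of_real (exp (- (1 * ((real n * r - 2) / sqrt 2))\<^sup>2 / 2))))"
        unfolding f_def by (intro has_bochner_integral_mult_right gaussian_fourier) simp
      moreover have "exp (1 - real n * r) * exp (- (1 * ((real n * r - 2) / sqrt 2))\<^sup>2 / 2) = exp (- (real n * r)\<^sup>2 / 4)"
      proof -
        have "(1 - real n * r) + - (1 * ((real n * r - 2) / sqrt 2))\<^sup>2 / 2 = - (real n * r)\<^sup>2 / 4"
          by (simp add: power_divide power2_eq_square field_simps)
        thus ?thesis by (simp only: flip: exp_add)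
      qed
      hence "h n * (cis ((real n * r - 2) / sqrt 2 * 0) * of_real (exp (- (1 * ((real n * r - 2) / sqrt 2))\<^sup>2 / 2)))
        = of_real (c n * exp (- \<delta>) ^ n * exp (- (real n * r)\<^sup>2 / 4)) * cis (real n * w)"
        unfolding h_def by (simp only: mult_zero_right cis_zero mult_1_left of_real_mult mult_ac flip: of_real_mult) (simp add: mult_ac)
      ultimately show ?thesis by (simp only:)
    qed
    have nh: "norm (h n) \<le> exp 1 * (c n * exp (- \<delta>) ^ n)" for n
    proof -
      have "norm (h n) = c n * exp (- \<delta>) ^ n * exp (1 - real n * r)"
        using c by (simp add: h_def norm_mult norm_power)
      also have "\<dots> \<le> c n * exp (- \<delta>) ^ n * exp 1"
        using c r by (intro mult_left_mono) auto
      finally show ?thesis by (simp add: mult_ac)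
    qed
    have sm: "summable (\<lambda>n. exp 1 * (c n * exp (- \<delta>) ^ n))"
      unfolding c_def using binomial_series_summable[of "exp (- \<delta>)" \<beta>] \<delta> \<beta>
      by (intro summable_mult) auto
    have nf: "norm (f n \<xi>) = norm (h n) * std_normal_density \<xi>" for n \<xi>
      by (simp add: f_def norm_mult)
    have f_integrable: "integrable lborel (f n)" for n using f_int by (auto simp: has_bochner_integral_iff)
    have smh: "summable (\<lambda>n. norm (h n))"
      using nh by (intro summable_comparison_test'[OF sm, of 0]) auto
    \<comment> \<open>The damping by powers of exp (- \<delta>) gives absolute convergence, so sum
      and integral may be interchanged. Its \<delta>-dependent size does not enter the final
      bound.\<close>
    have ae: "AE \<xi> in lborel. summable (\<lambda>n. norm (f n \<xi>))"
      unfolding nf using smh by (auto intro: summable_mult2)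
    have sml: "summable (\<lambda>n. LINT \<xi>|lborel. norm (f n \<xi>))" unfolding nf using smh by simp
    note sums = sums_integral[OF f_integrable ae sml]
    \<comment> \<open>Once the factors free of n are taken out, namely exp 1, the density and the
      phase left by the shift, a binomial series in \<zeta> remains.\<close>
    have lim: "(\<Sum>n. f n \<xi>) = of_real (exp 1 * std_normal_density \<xi>) * cis (- (sqrt 2 * \<xi>)) * (1 - \<zeta> \<xi>) powr (- of_real \<beta>)" for \<xi>
    proof -
      have "norm (\<zeta> \<xi>) < 1" using \<delta> r by (simp add: \<zeta>_def norm_mult)
      hence "(\<lambda>n. of_real (exp 1 * std_normal_density \<xi>) * cis (- (sqrt 2 * \<xi>)) * (of_real (c n) * \<zeta> \<xi> ^ n))
         sums (of_real (exp 1 * std_normal_density \<xi>) * cis (- (sqrt 2 * \<xi>)) * (1 - \<zeta> \<xi>) powr (- of_real \<beta>))"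
        unfolding c_def by (intro sums_mult binomial_series_sums)
      moreover have "of_real (exp 1 * std_normal_density \<xi>) * cis (- (sqrt 2 * \<xi>)) * (of_real (c n) * \<zeta> \<xi> ^ n) = f n \<xi>" for n
      proof -
        have "\<zeta> \<xi> ^ n = of_real (exp (- (\<delta> + r)) ^ n) * cis (real n * (w + r * \<xi> / sqrt 2))"
          by (simp add: \<zeta>_def power_mult_distrib Complex.DeMoivre)
        moreover have "exp (- (\<delta> + r)) ^ n * exp 1 = exp (- \<delta>) ^ n * exp (1 - real n * r)"
          unfolding exp_of_nat_mult[symmetric] exp_add[symmetric] by (simp add: algebra_simps)
        moreover have "cis (real n * (w + r * \<xi> / sqrt 2)) * cis (- (sqrt 2 * \<xi>)) = cis (real n * w) * cis ((real n * r - 2) / sqrt 2 * \<xi>)"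
        proof -
          have "2 / sqrt 2 = sqrt 2" by (simp add: real_div_sqrt)
          hence "(real n * r - 2) / sqrt 2 * \<xi> = real n * (r * \<xi> / sqrt 2) - sqrt 2 * \<xi>"
            by (simp add: diff_divide_distrib algebra_simps)
          thus ?thesis unfolding cis_mult by (simp only:) (simp add: algebra_simps)
        qed
        ultimately have "of_real (std_normal_density \<xi> * c n) * of_real (exp (- (\<delta> + r)) ^ n * exp 1) * (cis (real n * (w + r * \<xi> / sqrt 2)) * cis (- (sqrt 2 * \<xi>)))
           = f n \<xi>" "\<zeta> \<xi> ^ n = of_real (exp (- (\<delta> + r)) ^ n) * cis (real n * (w + r * \<xi> / sqrt 2))"
          unfolding f_def h_def by (simp_all only: of_real_mult mult_ac)
        thus ?thesis by (simp only: of_real_mult mult_ac)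
      qed
      ultimately show ?thesis by (simp add: sums_iff)
    qed
    have bound: "norm (\<Sum>n. f n \<xi>) \<le> exp 1 * 8 powr \<beta> * M powr (- \<beta>) * (std_normal_density \<xi> * (1 + \<bar>\<xi>\<bar>) ^ b)" for \<xi>
    proof -
      define D where "D = norm (1 - \<zeta> \<xi>)"
      have D: "M \<le> 8 * (1 + \<bar>\<xi>\<bar>) * D"
        using max_le_norm_one_minus_polar[OF \<delta> w r, of \<xi>] by (simp add: M_def D_def \<zeta>_def)
      have D0: "D > 0"
      proof -
        have "D \<noteq> 0" using D M by auto
        thus ?thesis by (simp add: D_def)
      qed
      have "norm ((1 - \<zeta> \<xi>) powr (- of_real \<beta>)) = D powr (- \<beta>)"
        using norm_powr_real_powr'[of "- of_real \<beta>" "1 - \<zeta> \<xi>"] by (simp add: D_def)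
      also have "\<dots> \<le> (M / (8 * (1 + \<bar>\<xi>\<bar>))) powr (- \<beta>)"
        using D M \<beta> by (intro powr_mono2') (auto simp: field_simps)
      also have "\<dots> = M powr (- \<beta>) * (8 powr \<beta> * (1 + \<bar>\<xi>\<bar>) powr \<beta>)"
      proof -
        have "(8 * (1 + \<bar>\<xi>\<bar>)) powr \<beta> = 8 powr \<beta> * (1 + \<bar>\<xi>\<bar>) powr \<beta>" by (rule powr_mult)
        moreover have "(M / (8 * (1 + \<bar>\<xi>\<bar>))) powr (- \<beta>) = M powr (- \<beta>) * (8 * (1 + \<bar>\<xi>\<bar>)) powr \<beta>"
          using M by (subst powr_divide) (auto simp: powr_minus field_simps)
        ultimately show ?thesis by simp
      qed
      also have "(1 + \<bar>\<xi>\<bar>) powr \<beta> \<le> (1 + \<bar>\<xi>\<bar>) powr real b"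
        unfolding b_def by (intro powr_mono real_nat_ceiling_ge) auto
      also have "\<dots> = (1 + \<bar>\<xi>\<bar>) ^ b" by (simp add: powr_realpow)
      finally have *: "norm ((1 - \<zeta> \<xi>) powr (- of_real \<beta>)) \<le> M powr (- \<beta>) * (8 powr \<beta> * (1 + \<bar>\<xi>\<bar>) ^ b)"
        by (simp add: mult_left_mono)
      have "norm (\<Sum>n. f n \<xi>) = exp 1 * std_normal_density \<xi> * norm ((1 - \<zeta> \<xi>) powr (- of_real \<beta>))"
        by (simp add: lim norm_mult)
      also have "\<dots> \<le> exp 1 * std_normal_density \<xi> * (M powr (- \<beta>) * (8 powr \<beta> * (1 + \<bar>\<xi>\<bar>) ^ b))"
        by (intro mult_left_mono *) auto
      finally show ?thesis by (simp add: mult_ac)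
    qed
    have "(\<Sum>n. of_real (c n * exp (- \<delta>) ^ n * exp (- (real n * r)\<^sup>2 / 4)) * cis (real n * w)) = (LINT \<xi>|lborel. (\<Sum>n. f n \<xi>))"
      using sums has_bochner_integral_integral_eq[OF f_int] by (simp add: sums_iff)
    also have "norm \<dots> \<le> (LINT \<xi>|lborel. exp 1 * 8 powr \<beta> * M powr (- \<beta>) * (std_normal_density \<xi> * (1 + \<bar>\<xi>\<bar>) ^ b))"
      by (rule Bochner_Integration.integral_norm_bound_integral[OF integrable_suminf[OF f_integrable ae sml]
            integrable_mult_right[OF integrable_std_normal_one_plus_abs_power] bound])
    also have "\<dots> = exp 1 * 8 powr \<beta> * I * M powr (- \<beta>)" by (simp add: I_def)
    also have "\<dots> \<le> K * M powr (- \<beta>)" unfolding K_def by (intro mult_right_mono mult_left_mono) auto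
    finally show ?thesis by (simp only: c_def M_def)
  qed
  ultimately show ?thesis by blast
qed

section \<open>Incidences and energies\<close>

lemma gaussian_gram:
  fixes x :: "'a \<Rightarrow> 'j \<Rightarrow> real" and m :: "'b \<Rightarrow> 'j \<Rightarrow> real"
  assumes N: "N > 0" and J: "finite J"
  defines "c \<equiv> sqrt ((1 + N\<^sup>2) / 2) / sqrt N"
  shows "gram_dominated X Y
     (\<lambda>p q. of_real (\<Prod>j\<in>J. c * exp (- (N * (x p j - x q j))\<^sup>2 / 4) * exp ((x p j + x q j)\<^sup>2 / 4)))
     (\<lambda>p h. \<Prod>j\<in>J. cis (- (N * m h j * x p j)) * of_real (exp (- (m h j)\<^sup>2 / 2)))
     (\<lambda>g h. of_real (\<Prod>j\<in>J. c * exp (- (N * (m g j - m h j))\<^sup>2 / 4) * exp (- (m g j - m h j)\<^sup>2 / 4)))"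
  using J
proof (induction J rule: finite_induct)
  case empty
  show ?case using gram_dominated_one by simp
next
  case (insert i J)
  show ?case
    using gaussian_gram_step[OF insert.IH N, of "\<lambda>p. x p i" "\<lambda>h. m h i"] insert.hyps
    unfolding c_def[symmetric] by (simp add: mult_ac)
qed

lemma prod_cis: "(\<Prod>j\<in>J. cis (f j)) = cis (\<Sum>j\<in>J. f j)"
  by (induction J rule: infinite_finite_induct) (auto simp: cis_mult)

text \<open>The coordinate solved for enters through the unimodular weights
  \<open>cis (N * w p)\<close> and \<open>cis (- (N * z h))\<close> alone and costs no power of
  \<open>N\<close>: the exponent of \<open>C\<close> is \<open>card J\<close>, one less than the
  dimension in the application.\<close>

lemma gaussian_gram_cos:
  fixes x :: "'a \<Rightarrow> 'j \<Rightarrow> real" and m :: "'b \<Rightarrow> 'j \<Rightarrow> real" and a w :: "'a \<Rightarrow> real" and b z :: "'b \<Rightarrow> real"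
  assumes N: "N > 0" and J: "finite J"
  defines "C \<equiv> (sqrt ((1 + N\<^sup>2) / 2) / sqrt N) ^ card J"
  shows "2 * (\<Sum>p\<in>X. \<Sum>h\<in>Y. a p * b h * cos (N * (w p - z h - (\<Sum>j\<in>J. m h j * x p j))))
    \<le> C * (\<Sum>p\<in>X. \<Sum>q\<in>X. a p * a q * exp (\<Sum>j\<in>J. (x p j + x q j)\<^sup>2 / 4) *
            (cos (N * (w p - w q)) * exp (- (N * L2_set (\<lambda>j. x p j - x q j) J)\<^sup>2 / 4)))
     + C * (\<Sum>g\<in>Y. \<Sum>h\<in>Y. b g * b h * exp ((\<Sum>j\<in>J. (m g j)\<^sup>2 / 2) + (\<Sum>j\<in>J. (m h j)\<^sup>2 / 2) - (\<Sum>j\<in>J. (m g j - m h j)\<^sup>2 / 4)) *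
            (cos (N * (z g - z h)) * exp (- (N * L2_set (\<lambda>j. m g j - m h j) J)\<^sup>2 / 4)))"
proof -
  define c where "c = sqrt ((1 + N\<^sup>2) / 2) / sqrt N"
  have Cc: "C = c ^ card J" by (simp add: C_def c_def)
  define u where "u = (\<lambda>p. of_real (a p) * cis (N * w p))"
  \<comment> \<open>The exponential undoes the loss exp (- m^2 / 2) in the phase kernel; it
    reappears in the second Gram form as a weight that is bounded for bounded slopes.\<close>
  define v where "v = (\<lambda>h. of_real (b h * exp (\<Sum>j\<in>J. (m h j)\<^sup>2 / 2)) * cis (- (N * z h)))"
  define A where "A = (\<lambda>p q. \<Prod>j\<in>J. c * exp (- (N * (x p j - x q j))\<^sup>2 / 4) * exp ((x p j + x q j)\<^sup>2 / 4))"
  define B where "B = (\<lambda>g h. \<Prod>j\<in>J. c * exp (- (N * (m g j - m h j))\<^sup>2 / 4) * exp (- (m g j - m h j)\<^sup>2 / 4))"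
  define F where "F = (\<lambda>p h. \<Prod>j\<in>J. cis (- (N * m h j * x p j)) * of_real (exp (- (m h j)\<^sup>2 / 2)))"
  have L2: "(N * L2_set f J)\<^sup>2 = (\<Sum>j\<in>J. (N * f j)\<^sup>2)" for f
    by (simp add: L2_set_def power_mult_distrib sum_nonneg sum_distrib_left)
  have A: "A p q = C * exp (- (N * L2_set (\<lambda>j. x p j - x q j) J)\<^sup>2 / 4) * exp (\<Sum>j\<in>J. (x p j + x q j)\<^sup>2 / 4)" for p q
    using J unfolding A_def L2 Cc
    by (simp add: prod.distrib exp_sum sum_divide_distrib flip: sum_negf)
  have B: "B g h = C * exp (- (N * L2_set (\<lambda>j. m g j - m h j) J)\<^sup>2 / 4) * exp (- (\<Sum>j\<in>J. (m g j - m h j)\<^sup>2 / 4))" for g h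
    using J unfolding B_def L2 Cc
    by (simp add: prod.distrib exp_sum sum_divide_distrib flip: sum_negf)
  have F: "F p h = cis (- (N * (\<Sum>j\<in>J. m h j * x p j))) * of_real (exp (- (\<Sum>j\<in>J. (m h j)\<^sup>2 / 2)))" for p h
    using J unfolding F_def
    by (simp add: prod.distrib prod_cis exp_sum sum_distrib_left mult.assoc flip: sum_negf of_real_prod)
  have "2 * Re (\<Sum>p\<in>X. \<Sum>h\<in>Y. u p * v h * F p h)
      \<le> Re (\<Sum>p\<in>X. \<Sum>q\<in>X. u p * cnj (u q) * of_real (A p q)) + Re (\<Sum>g\<in>Y. \<Sum>h\<in>Y. v g * cnj (v h) * of_real (B g h))"
    using gaussian_gram[OF N J, of X Y x m] unfolding gram_dominated_def A_def B_def F_def c_def by blast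
  moreover have "Re (u p * v h * F p h) = a p * b h * cos (N * (w p - z h - (\<Sum>j\<in>J. m h j * x p j)))" for p h
  proof -
    define E where "E = (\<Sum>j\<in>J. (m h j)\<^sup>2 / 2)"
    have 1: "u p * v h * F p h = of_real (a p * b h * (exp E * exp (- E))) *
       (cis (N * w p) * cis (- (N * z h)) * cis (- (N * (\<Sum>j\<in>J. m h j * x p j))))"
      by (simp add: u_def v_def F E_def mult_ac)
    have 2: "cis (N * w p) * cis (- (N * z h)) * cis (- (N * (\<Sum>j\<in>J. m h j * x p j)))
       = cis (N * (w p - z h - (\<Sum>j\<in>J. m h j * x p j)))"
      by (simp add: cis_mult algebra_simps)
    show ?thesis unfolding 1 2 by (simp add: exp_minus)
  qed
  moreover have "Re (u p * cnj (u q) * of_real (A p q)) = C * (a p * a q * exp (\<Sum>j\<in>J. (x p j + x q j)\<^sup>2 / 4) *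
            (cos (N * (w p - w q)) * exp (- (N * L2_set (\<lambda>j. x p j - x q j) J)\<^sup>2 / 4)))" for p q
  proof -
    have 1: "u p * cnj (u q) * of_real (A p q) = of_real (a p * a q * A p q) * (cis (N * w p) * cis (- (N * w q)))"
      by (simp add: u_def cis_cnj mult_ac)
    have 2: "cis (N * w p) * cis (- (N * w q)) = cis (N * (w p - w q))"
      by (simp add: cis_mult algebra_simps)
    have "Re (u p * cnj (u q) * of_real (A p q)) = a p * a q * A p q * cos (N * (w p - w q))"
      unfolding 1 2 by simp
    thus ?thesis by (simp only: A mult_ac)
  qed
  moreover have "Re (v g * cnj (v h) * of_real (B g h)) = C * (b g * b h * exp ((\<Sum>j\<in>J. (m g j)\<^sup>2 / 2) + (\<Sum>j\<in>J. (m h j)\<^sup>2 / 2) - (\<Sum>j\<in>J. (m g j - m h j)\<^sup>2 / 4)) *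
            (cos (N * (z g - z h)) * exp (- (N * L2_set (\<lambda>j. m g j - m h j) J)\<^sup>2 / 4)))" for g h
  proof -
    have 1: "v g * cnj (v h) * of_real (B g h) = of_real (b g * b h * (exp (\<Sum>j\<in>J. (m g j)\<^sup>2 / 2) * exp (\<Sum>j\<in>J. (m h j)\<^sup>2 / 2)) * B g h) * (cis (- (N * z g)) * cis (N * z h))"
      by (simp add: v_def cis_cnj mult_ac)
    have 2: "cis (- (N * z g)) * cis (N * z h) = cis (- (N * (z g - z h)))"
      by (simp add: cis_mult algebra_simps)
    have "Re (v g * cnj (v h) * of_real (B g h))
      = b g * b h * (exp (\<Sum>j\<in>J. (m g j)\<^sup>2 / 2) * exp (\<Sum>j\<in>J. (m h j)\<^sup>2 / 2)) * B g h * cos (N * (z g - z h))"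
      unfolding 1 2 by simp
    thus ?thesis by (simp add: B diff_conv_add_uminus exp_add mult_ac del: add_uminus_conv_diff)
  qed
  ultimately show ?thesis by (simp only: Re_sum sum_distrib_left)
qed

text \<open>Real part of \<open>gaussian_binomial_series_bound\<close>, put as a one-sided estimate
  of the limit, since the limits are later added with nonnegative weights.\<close>

lemma gaussian_cosine_series_bound:
  fixes \<beta> :: real
  assumes \<beta>: "\<beta> > 0"
  shows "\<exists>K>0. \<forall>\<delta> w r. 0 < \<delta> \<and> \<delta> \<le> 1 \<and> \<bar>w\<bar> \<le> 1 \<and> 0 \<le> r \<and> r \<le> 2 \<longrightarrow>
    (\<exists>T \<le> K * (max \<delta> (max \<bar>w\<bar> r)) powr (- \<beta>).
      (\<lambda>n. pochhammer \<beta> n / fact n * exp (- \<delta>) ^ n * (cos (real n * w) * exp (- (real n * r)\<^sup>2 / 4))) sums T)"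
proof -
  define f where "f = (\<lambda>\<delta> w r n. of_real (pochhammer \<beta> n / fact n * exp (- \<delta>) ^ n * exp (- (real n * r)\<^sup>2 / 4)) * cis (real n * w))"
  obtain K where K: "K > 0" "\<And>\<delta> w r. 0 < \<delta> \<Longrightarrow> \<delta> \<le> 1 \<Longrightarrow> \<bar>w\<bar> \<le> 1 \<Longrightarrow> 0 \<le> r \<Longrightarrow> r \<le> 2 \<Longrightarrow>
    norm (\<Sum>n. f \<delta> w r n) \<le> K * (max \<delta> (max \<bar>w\<bar> r)) powr (- \<beta>)"
    using gaussian_binomial_series_bound[OF \<beta>] unfolding f_def by blast
  have "\<exists>T \<le> K * (max \<delta> (max \<bar>w\<bar> r)) powr (- \<beta>).
      (\<lambda>n. pochhammer \<beta> n / fact n * exp (- \<delta>) ^ n * (cos (real n * w) * exp (- (real n * r)\<^sup>2 / 4))) sums T"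
    if *: "0 < \<delta>" "\<delta> \<le> 1" "\<bar>w\<bar> \<le> 1" "0 \<le> r" "r \<le> 2" for \<delta> w r
  proof -
    have "norm (f \<delta> w r n) \<le> pochhammer \<beta> n / fact n * exp (- \<delta>) ^ n" for n
    proof -
      have p: "pochhammer \<beta> n / fact n * exp (- \<delta>) ^ n \<ge> 0" using \<beta> by (simp add: pochhammer_nonneg)
      have "norm (f \<delta> w r n) = norm (pochhammer \<beta> n / fact n * exp (- \<delta>) ^ n * exp (- (real n * r)\<^sup>2 / 4))"
        by (simp only: f_def norm_mult[of _ "cis _"] norm_of_real norm_cis real_norm_def mult_1_right)
      also have "\<dots> = pochhammer \<beta> n / fact n * exp (- \<delta>) ^ n * exp (- (real n * r)\<^sup>2 / 4)"
        using p by (simp only: real_norm_def abs_mult abs_exp_cancel) (simp only: abs_of_nonneg flip: abs_mult)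
      also have "\<dots> \<le> pochhammer \<beta> n / fact n * exp (- \<delta>) ^ n * 1"
        by (intro mult_left_mono p) simp
      finally show ?thesis by simp
    qed
    moreover have "summable (\<lambda>n. pochhammer \<beta> n / fact n * exp (- \<delta>) ^ n)"
      using * \<beta> by (intro binomial_series_summable) auto
    ultimately have "summable (f \<delta> w r)" by (rule summable_comparison_test'[where N = 0, rotated])
    hence "(\<lambda>n. Re (f \<delta> w r n)) sums Re (\<Sum>n. f \<delta> w r n)" by (intro sums_Re summable_sums)
    moreover have "Re (f \<delta> w r n) = pochhammer \<beta> n / fact n * exp (- \<delta>) ^ n * (cos (real n * w) * exp (- (real n * r)\<^sup>2 / 4))" for n
    proof -
      have "Re (of_real a * cis t) = a * cos t" for a t by simp
      thus ?thesis by (simp only: f_def mult_ac)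
    qed
    moreover have "Re (\<Sum>n. f \<delta> w r n) \<le> K * (max \<delta> (max \<bar>w\<bar> r)) powr (- \<beta>)"
      using K(2)[OF *] complex_Re_le_cmod order_trans by blast
    ultimately show ?thesis by auto
  qed
  thus ?thesis using K(1) by blast
qed

text \<open>The series is summed for each pair and only then estimated, so that the cancellation in
  n of cos (n (w p - w q)) is kept. The weights \<open>g\<close> are nonnegative and free of n, so
  they pass through the sum.\<close>

lemma energy_series_bound:
  fixes w :: "'a \<Rightarrow> real" and r g :: "'a \<Rightarrow> 'a \<Rightarrow> real"
  assumes K: "\<And>w r. \<bar>w\<bar> \<le> 1 \<Longrightarrow> 0 \<le> r \<Longrightarrow> r \<le> 2 \<Longrightarrow>
      \<exists>T \<le> K * (max \<delta> (max \<bar>w\<bar> r)) powr (- \<beta>).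
        (\<lambda>n. C n * (cos (real n * w) * exp (- (real n * r)\<^sup>2 / 4))) sums T"
    and K0: "K > 0"
    and g: "\<And>p q. p \<in> X \<Longrightarrow> q \<in> X \<Longrightarrow> 0 \<le> g p q \<and> g p q \<le> G"
    and b: "\<And>p q. p \<in> X \<Longrightarrow> q \<in> X \<Longrightarrow> \<bar>w p - w q\<bar> \<le> 1 \<and> 0 \<le> r p q \<and> r p q \<le> 2"
  shows "\<exists>S \<le> G * K * (\<Sum>p\<in>X. \<Sum>q\<in>X. (max \<delta> (max \<bar>w p - w q\<bar> (r p q))) powr (- \<beta>)).
    (\<lambda>n. C n * (\<Sum>p\<in>X. \<Sum>q\<in>X. g p q * (cos (real n * (w p - w q)) * exp (- (real n * r p q)\<^sup>2 / 4)))) sums S"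
proof -
  define M where "M = (\<lambda>p q. (max \<delta> (max \<bar>w p - w q\<bar> (r p q))) powr (- \<beta>))"
  have "\<forall>p q. \<exists>T. p \<in> X \<longrightarrow> q \<in> X \<longrightarrow> T \<le> K * M p q \<and>
    (\<lambda>n. C n * (cos (real n * (w p - w q)) * exp (- (real n * r p q)\<^sup>2 / 4))) sums T"
    using K b unfolding M_def by blast
  then obtain T where T: "\<forall>p q. p \<in> X \<longrightarrow> q \<in> X \<longrightarrow> T p q \<le> K * M p q \<and>
    (\<lambda>n. C n * (cos (real n * (w p - w q)) * exp (- (real n * r p q)\<^sup>2 / 4))) sums T p q"
    unfolding choice_iff by blast
  have "(\<lambda>n. \<Sum>p\<in>X. \<Sum>q\<in>X. g p q * (C n * (cos (real n * (w p - w q)) * exp (- (real n * r p q)\<^sup>2 / 4))))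
     sums (\<Sum>p\<in>X. \<Sum>q\<in>X. g p q * T p q)"
    using T by (intro sums_sum sums_mult) blast
  hence "(\<lambda>n. C n * (\<Sum>p\<in>X. \<Sum>q\<in>X. g p q * (cos (real n * (w p - w q)) * exp (- (real n * r p q)\<^sup>2 / 4))))
     sums (\<Sum>p\<in>X. \<Sum>q\<in>X. g p q * T p q)"
    by (simp add: sum_distrib_left mult_ac)
  moreover have "(\<Sum>p\<in>X. \<Sum>q\<in>X. g p q * T p q) \<le> (\<Sum>p\<in>X. \<Sum>q\<in>X. G * (K * M p q))"
  proof (intro sum_mono)
    fix p q assume pq: "p \<in> X" "q \<in> X"
    have "g p q * T p q \<le> g p q * (K * M p q)" using g T pq by (intro mult_left_mono) auto
    also have "\<dots> \<le> G * (K * M p q)" using g pq K0 by (intro mult_right_mono) (auto simp: M_def)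
    finally show "g p q * T p q \<le> G * (K * M p q)" .
  qed
  ultimately show ?thesis by (auto simp: M_def sum_distrib_left mult_ac)
qed

section \<open>The kernel on incidences and the counting argument\<close>

text \<open>The real part is (1 - q cos u) / |1 - q e^{iu}|^2. The numerator is at least 1 - q \<ge>
  \<delta> / 2, and for |u| \<le> L \<delta> the denominator is at most ((1 + L)
  \<delta>)^2.\<close>

lemma Re_inverse_one_minus_polar:
  fixes \<delta> u :: real
  assumes \<delta>: "0 < \<delta>" "\<delta> \<le> 1"
  shows "0 \<le> Re (1 / (1 - of_real (exp (- \<delta>)) * cis u))"
    and "L > 0 \<Longrightarrow> \<bar>u\<bar> \<le> L * \<delta> \<Longrightarrow> 1 / (2 * (1 + L)\<^sup>2 * \<delta>) \<le> Re (1 / (1 - of_real (exp (- \<delta>)) * cis u))"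
proof -
  define q where "q = exp (- \<delta>)"
  define D where "D = norm (1 - of_real q * cis u)"
  have q: "0 < q" "q < 1" using \<delta> by (auto simp: q_def)
  have Re: "Re (1 / (1 - of_real q * cis u)) = (1 - q * cos u) / D\<^sup>2"
    by (simp add: D_def Re_divide cmod_power2)
  have c: "1 - q \<le> 1 - q * cos u" using q by (simp add: mult_left_le)
  show "0 \<le> Re (1 / (1 - of_real (exp (- \<delta>)) * cis u))"
    unfolding q_def[symmetric] Re using c q by (intro divide_nonneg_nonneg zero_le_power2) linarith
  assume L: "L > 0" and u: "\<bar>u\<bar> \<le> L * \<delta>"
  have q1: "\<delta> / 2 \<le> 1 - q"
  proof -
    have "inverse (exp \<delta>) \<le> inverse (1 + \<delta>)"
      using \<delta> by (intro le_imp_inverse_le exp_ge_add_one_self) auto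
    also have "\<dots> \<le> 1 - \<delta> / 2"
    proof -
      have "0 \<le> \<delta> * (1 - \<delta>)" using \<delta> by (intro mult_nonneg_nonneg) auto
      hence "1 \<le> (1 - \<delta> / 2) * (1 + \<delta>)" by (simp add: algebra_simps)
      thus ?thesis using \<delta> by (simp add: inverse_eq_divide pos_divide_le_eq)
    qed
    finally have "q \<le> 1 - \<delta> / 2" unfolding q_def exp_minus .
    thus ?thesis by linarith
  qed
  have q2: "1 - q \<le> \<delta>" using exp_ge_add_one_self[of "- \<delta>"] by (simp add: q_def)
  have "D = norm (of_real (1 - q) + of_real q * (1 - cis u))" by (simp add: D_def algebra_simps)
  also have "\<dots> \<le> norm (of_real (1 - q) :: complex) + norm (of_real q * (1 - cis u))" by (rule norm_triangle_ineq)
  also have "norm (of_real (1 - q) :: complex) = 1 - q" using q unfolding norm_of_real by simp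
  also have "norm (of_real q * (1 - cis u)) \<le> \<bar>u\<bar>"
  proof -
    have "norm (1 - cis u) \<le> \<bar>u\<bar>"
      using iexp_approx1[of u 0] by (simp add: cis_conv_exp norm_minus_commute)
    moreover have "norm (of_real q * (1 - cis u)) \<le> norm (1 - cis u)"
      using q by (simp add: norm_mult mult_left_le_one_le)
    ultimately show ?thesis by linarith
  qed
  finally have "D \<le> \<delta> + L * \<delta>" using q2 u by linarith
  hence D: "D \<le> (1 + L) * \<delta>" by (simp add: algebra_simps)
  have D0: "D > 0"
  proof -
    have "1 - q * cos u > 0" using c q by linarith
    hence "Re (1 - of_real q * cis u) \<noteq> 0" by simp
    thus ?thesis unfolding D_def by (metis norm_eq_zero zero_complex.sel(1) zero_less_norm_iff)
  qed
  have "1 / (2 * (1 + L)\<^sup>2 * \<delta>) = (\<delta> * 1) / (\<delta> * (2 * (1 + L)\<^sup>2 * \<delta>))"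
    using \<delta> by (simp only: mult_divide_mult_cancel_left)
  also have "\<dots> = (\<delta> / 2) / ((1 + L) * \<delta>)\<^sup>2"
    by (simp add: power_mult_distrib power2_eq_square[of \<delta>] mult_ac)
  also have "\<dots> \<le> (1 - q * cos u) / D\<^sup>2"
  proof (intro frac_le power_mono zero_less_power D D0)
    show "0 \<le> 1 - q * cos u" "\<delta> / 2 \<le> 1 - q * cos u" using q1 c q by linarith+
  qed (use D0 in simp)
  finally show "1 / (2 * (1 + L)\<^sup>2 * \<delta>) \<le> Re (1 / (1 - of_real (exp (- \<delta>)) * cis u))"
    unfolding q_def[symmetric] Re .
qed

lemma exp_sum_le:
  fixes f :: "'j \<Rightarrow> real"
  assumes "\<And>j. j \<in> J \<Longrightarrow> f j \<le> 1"
  shows "exp (sum f J) \<le> exp (card J)"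
  using sum_bounded_above[of J f 1] assms by simp

text \<open>\<open>A\<close> and \<open>B\<close> are upper bounds instead of the cardinalities
  themselves because the lemma is applied to one class of hyperplanes inside \<open>H\<close>. Such
  a class may be much smaller than \<open>H\<close>, and its energy is controlled only relative to
  the size of \<open>H\<close>.\<close>

lemma energy_incidence_bound:
  fixes J :: "'j set" and L E :: real
  assumes J: "finite J" and L: "L > 0" and E: "E > 0"
  defines "\<beta> \<equiv> card J / 2 + 1"
  shows "\<exists>K>0. \<forall>\<delta> (X :: 'a set) (Y :: 'b set) w x z m A B.
    0 < \<delta> \<and> \<delta> \<le> 1 \<and> 0 < A \<and> 0 < B \<and> finite X \<and> finite Y \<and> real (card X) \<le> A \<and> real (card Y) \<le> B \<and>
    (\<forall>p\<in>X. \<forall>j\<in>J. \<bar>x p j\<bar> \<le> 1) \<and> (\<forall>h\<in>Y. \<forall>j\<in>J. \<bar>m h j\<bar> \<le> 1) \<and>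
    (\<forall>p\<in>X. \<forall>q\<in>X. \<bar>w p - w q\<bar> \<le> 1 \<and> L2_set (\<lambda>j. x p j - x q j) J \<le> 2) \<and>
    (\<forall>g\<in>Y. \<forall>h\<in>Y. \<bar>z g - z h\<bar> \<le> 1 \<and> L2_set (\<lambda>j. m g j - m h j) J \<le> 2) \<and>
    (\<Sum>p\<in>X. \<Sum>q\<in>X. (max \<delta> (max \<bar>w p - w q\<bar> (L2_set (\<lambda>j. x p j - x q j) J))) powr (- \<beta>)) \<le> E * A\<^sup>2 \<and>
    (\<Sum>g\<in>Y. \<Sum>h\<in>Y. (max \<delta> (max \<bar>z g - z h\<bar> (L2_set (\<lambda>j. m g j - m h j) J))) powr (- \<beta>)) \<le> E * B\<^sup>2
    \<longrightarrow> real (card {(p, h). p \<in> X \<and> h \<in> Y \<and> \<bar>w p - z h - (\<Sum>j\<in>J. m h j * x p j)\<bar> \<le> L * \<delta>}) \<le> K * \<delta> * A * B"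
proof -
  have \<beta>: "\<beta> > 0" unfolding \<beta>_def by (simp add: add_nonneg_pos)
  define c where "c = (\<lambda>n. pochhammer \<beta> n / fact n)"
  have c0: "c n \<ge> 0" for n using \<beta> by (simp add: c_def pochhammer_nonneg)
  obtain K1 where K1: "K1 > 0" "\<And>n. n \<ge> 1 \<Longrightarrow> real n powr (\<beta> - 1) \<le> K1 * c n"
    using powr_le_binomial_coeff[OF \<beta>] unfolding c_def by blast
  obtain K2 where K2: "K2 > 0" "\<And>\<delta> w r. 0 < \<delta> \<Longrightarrow> \<delta> \<le> 1 \<Longrightarrow> \<bar>w\<bar> \<le> 1 \<Longrightarrow> 0 \<le> r \<Longrightarrow> r \<le> 2 \<Longrightarrow>
    \<exists>T \<le> K2 * (max \<delta> (max \<bar>w\<bar> r)) powr (- \<beta>).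
      (\<lambda>n. c n * exp (- \<delta>) ^ n * (cos (real n * w) * exp (- (real n * r)\<^sup>2 / 4))) sums T"
    using gaussian_cosine_series_bound[OF \<beta>] unfolding c_def by blast
  \<comment> \<open>Each coordinate adds at most 1 to the exponent of either Gram weight, because
    |x| and |m| are at most 1.\<close>
  define G where "G = exp (real (card J))"
  \<comment> \<open>\<open>Q\<close> bounds the normalised sum of the kernel over all pairs: 1 comes
    from n = 0, and the two Gram series contribute K1 * (G * K2 * E) each, halved by the 2 in front
    of the real part. \<open>K\<close> then divides by the lower bound of the kernel on
    incidences.\<close>
  define Q where "Q = 1 + K1 * (G * K2 * E)"
  have Q: "Q > 0" using K1 K2 E by (simp add: Q_def G_def add_pos_pos)
  define K where "K = 2 * (1 + L)\<^sup>2 * Q"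
  have K: "K > 0" using Q L by (simp add: K_def)
  have bound: "real (card {(p, h). p \<in> X \<and> h \<in> Y \<and> \<bar>w p - z h - (\<Sum>j\<in>J. m h j * x p j)\<bar> \<le> L * \<delta>}) \<le> K * \<delta> * A * B"
    if \<delta>: "0 < \<delta>" "\<delta> \<le> 1" and AB: "0 < A" "0 < B" and fin: "finite X" "finite Y"
      and card: "real (card X) \<le> A" "real (card Y) \<le> B"
      and x: "\<forall>p\<in>X. \<forall>j\<in>J. \<bar>x p j\<bar> \<le> 1" and m: "\<forall>h\<in>Y. \<forall>j\<in>J. \<bar>m h j\<bar> \<le> 1"
      and wx: "\<forall>p\<in>X. \<forall>q\<in>X. \<bar>w p - w q\<bar> \<le> 1 \<and> L2_set (\<lambda>j. x p j - x q j) J \<le> 2"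
      and zm: "\<forall>g\<in>Y. \<forall>h\<in>Y. \<bar>z g - z h\<bar> \<le> 1 \<and> L2_set (\<lambda>j. m g j - m h j) J \<le> 2"
      and EX: "(\<Sum>p\<in>X. \<Sum>q\<in>X. (max \<delta> (max \<bar>w p - w q\<bar> (L2_set (\<lambda>j. x p j - x q j) J))) powr (- \<beta>)) \<le> E * A\<^sup>2"
      and EY: "(\<Sum>g\<in>Y. \<Sum>h\<in>Y. (max \<delta> (max \<bar>z g - z h\<bar> (L2_set (\<lambda>j. m g j - m h j) J))) powr (- \<beta>)) \<le> E * B\<^sup>2"
    for \<delta> and X :: "'a set" and Y :: "'b set" and w x z m A B
  proof -
    define q where "q = exp (- \<delta>)"
    have q: "0 < q" "q < 1" using \<delta> by (auto simp: q_def)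
    define r where "r = (\<lambda>p q. L2_set (\<lambda>j. x p j - x q j) J)"
    define s where "s = (\<lambda>g h. L2_set (\<lambda>j. m g j - m h j) J)"
    define gX where "gX = (\<lambda>p q. (1 / A) * (1 / A) * exp (\<Sum>j\<in>J. (x p j + x q j)\<^sup>2 / 4))"
    define gY where "gY = (\<lambda>g h. (1 / B) * (1 / B) * exp ((\<Sum>j\<in>J. (m g j)\<^sup>2 / 2) + (\<Sum>j\<in>J. (m h j)\<^sup>2 / 2) - (\<Sum>j\<in>J. (m g j - m h j)\<^sup>2 / 4)))"
    define QX where "QX = (\<lambda>n::nat. \<Sum>p\<in>X. \<Sum>q\<in>X. gX p q * (cos (real n * (w p - w q)) * exp (- (real n * r p q)\<^sup>2 / 4)))"
    define QY where "QY = (\<lambda>n::nat. \<Sum>p\<in>Y. \<Sum>q\<in>Y. gY p q * (cos (real n * (z p - z q)) * exp (- (real n * s p q)\<^sup>2 / 4)))"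
    define U where "U = (\<lambda>p h. w p - z h - (\<Sum>j\<in>J. m h j * x p j))"
    define S where "S = (\<lambda>n::nat. \<Sum>p\<in>X. \<Sum>h\<in>Y. (1 / A) * (1 / B) * cos (real n * U p h))"
    define C where "C = (\<lambda>n::nat. (sqrt ((1 + (real n)\<^sup>2) / 2) / sqrt (real n)) ^ card J)"
    \<comment> \<open>Zero weights on one side turn the Gram inequality into nonnegativity of the
      other form.\<close>
    have gram: "2 * S n \<le> C n * QX n + C n * QY n" and gX: "0 \<le> C n * QX n" and gY: "0 \<le> C n * QY n" if "n \<ge> 1" for n
    proof -
      have n: "real n > 0" using that by simp
      show "2 * S n \<le> C n * QX n + C n * QY n"
        using gaussian_gram_cos[OF n J, where a = "\<lambda>_. 1 / A" and b = "\<lambda>_. 1 / B" and X = X and Y = Y and x = x and m = m and w = w and z = z]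
        unfolding S_def U_def C_def QX_def QY_def gX_def gY_def r_def s_def .
      show "0 \<le> C n * QX n"
        using gaussian_gram_cos[OF n J, where a = "\<lambda>_. 1 / A" and b = "\<lambda>_. 0" and X = X and Y = Y and x = x and m = m and w = w and z = z]
        unfolding S_def U_def C_def QX_def QY_def gX_def gY_def r_def s_def by simp
      show "0 \<le> C n * QY n"
        using gaussian_gram_cos[OF n J, where a = "\<lambda>_. 0" and b = "\<lambda>_. 1 / B" and X = X and Y = Y and x = x and m = m and w = w and z = z]
        unfolding S_def U_def C_def QX_def QY_def gX_def gY_def r_def s_def by simp
    qed
    \<comment> \<open>Nonnegativity of \<open>QX n\<close> and \<open>QY n\<close> permits enlarging
      \<open>C n\<close> to \<open>K1 * c n\<close> before summation. The Gram bound requires N > 0,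
      so n = 0 is handled by S 0 \<le> 1; the forms at 0 are added on the right only to complete the
      binomial series.\<close>
    have step: "2 * S n \<le> (if n = 0 then 2 else 0) + K1 * (c n * QX n + c n * QY n)" for n
    proof (cases "n = 0")
      case True
      have "S 0 = (card X / A) * (card Y / B)" by (simp add: S_def)
      also have "\<dots> \<le> 1 * 1" using card AB by (intro mult_mono) auto
      finally have "S 0 \<le> 1" by simp
      moreover have "QX 0 \<ge> 0" "QY 0 \<ge> 0" unfolding QX_def QY_def gX_def gY_def using AB
        by (auto intro!: sum_nonneg)
      hence "0 \<le> K1 * (c 0 * QX 0 + c 0 * QY 0)" using K1 c0[of 0] by (intro mult_nonneg_nonneg add_nonneg_nonneg) auto
      ultimately show ?thesis using True by simp
    next
      case False
      hence n: "n \<ge> 1" by simp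
      have C: "C n > 0" using n unfolding C_def by (intro zero_less_power divide_pos_pos) (auto simp: add_pos_nonneg)
      have QQ: "QX n \<ge> 0" "QY n \<ge> 0" using gX[OF n] gY[OF n] C by (simp_all add: zero_le_mult_iff)
      \<comment> \<open>Each of the \<open>card J\<close> coordinates costs at most sqrt n, and
        \<beta> is defined so that together they make up n^(\<beta> - 1).\<close>
      have "C n \<le> sqrt (real n) ^ card J"
        unfolding C_def
      proof (intro power_mono)
        have "(1 + (real n)\<^sup>2) / 2 \<le> (real n)\<^sup>2" using n by simp
        hence "sqrt ((1 + (real n)\<^sup>2) / 2) \<le> sqrt ((real n)\<^sup>2)" by (rule real_sqrt_le_mono)
        hence "sqrt ((1 + (real n)\<^sup>2) / 2) \<le> sqrt (real n) * sqrt (real n)" by simp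
        thus "sqrt ((1 + (real n)\<^sup>2) / 2) / sqrt (real n) \<le> sqrt (real n)"
          using n by (simp add: pos_divide_le_eq del: real_sqrt_mult_self)
      qed auto
      also have "\<dots> = real n powr (\<beta> - 1)"
        using n by (simp add: \<beta>_def powr_half_sqrt[symmetric] powr_powr mult.commute flip: powr_realpow)
      also have "\<dots> \<le> K1 * c n" by (rule K1(2)[OF n])
      finally have "C n * (QX n + QY n) \<le> K1 * c n * (QX n + QY n)" using QQ by (intro mult_right_mono) auto
      thus ?thesis using gram[OF n] False by (simp add: algebra_simps)
    qed
    have "\<exists>SX \<le> (G / A\<^sup>2) * K2 * (\<Sum>p\<in>X. \<Sum>q\<in>X. (max \<delta> (max \<bar>w p - w q\<bar> (r p q))) powr (- \<beta>)).
        (\<lambda>n. (c n * q ^ n) * QX n) sums SX" unfolding QX_def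
    proof (rule energy_series_bound)
      fix p p' assume pp: "p \<in> X" "p' \<in> X"
      have "exp (\<Sum>j\<in>J. (x p j + x p' j)\<^sup>2 / 4) \<le> G" unfolding G_def
      proof (rule exp_sum_le)
        fix j assume "j \<in> J"
        hence "\<bar>x p j + x p' j\<bar> \<le> 2" using x pp by (smt (verit))
        hence "(x p j + x p' j)\<^sup>2 \<le> 2\<^sup>2" using abs_le_square_iff[of "x p j + x p' j" 2] by simp
        thus "(x p j + x p' j)\<^sup>2 / 4 \<le> 1" by simp
      qed
      thus "0 \<le> gX p p' \<and> gX p p' \<le> G / A\<^sup>2" using AB by (simp add: gX_def power2_eq_square divide_right_mono)
      show "\<bar>w p - w p'\<bar> \<le> 1 \<and> 0 \<le> r p p' \<and> r p p' \<le> 2" using wx pp by (simp add: r_def)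
    qed (use K2 \<delta> in \<open>auto simp: q_def\<close>)
    then obtain SX where SX: "SX \<le> (G / A\<^sup>2) * K2 * (\<Sum>p\<in>X. \<Sum>q\<in>X. (max \<delta> (max \<bar>w p - w q\<bar> (r p q))) powr (- \<beta>))"
      "(\<lambda>n. (c n * q ^ n) * QX n) sums SX" by blast
    have "SX \<le> (G / A\<^sup>2) * K2 * (E * A\<^sup>2)"
      using SX(1) EX K2 unfolding r_def by (elim order_trans, intro mult_left_mono) (auto simp: G_def)
    hence SX': "SX \<le> G * K2 * E" using AB by simp
    have "\<exists>SY \<le> (G / B\<^sup>2) * K2 * (\<Sum>p\<in>Y. \<Sum>q\<in>Y. (max \<delta> (max \<bar>z p - z q\<bar> (s p q))) powr (- \<beta>)).
        (\<lambda>n. (c n * q ^ n) * QY n) sums SY" unfolding QY_def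
    proof (rule energy_series_bound)
      fix p p' assume pp: "p \<in> Y" "p' \<in> Y"
      have "exp ((\<Sum>j\<in>J. (m p j)\<^sup>2 / 2) + (\<Sum>j\<in>J. (m p' j)\<^sup>2 / 2) - (\<Sum>j\<in>J. (m p j - m p' j)\<^sup>2 / 4))
        = exp (\<Sum>j\<in>J. (m p j)\<^sup>2 / 2 + (m p' j)\<^sup>2 / 2 - (m p j - m p' j)\<^sup>2 / 4)"
        by (simp add: sum.distrib sum_subtractf)
      also have "\<dots> \<le> G" unfolding G_def
      proof (rule exp_sum_le)
        fix j assume "j \<in> J"
        hence "(m p j)\<^sup>2 \<le> 1" "(m p' j)\<^sup>2 \<le> 1" using m pp by (auto simp: abs_square_le_1)
        moreover have "0 \<le> (m p j - m p' j)\<^sup>2" by simp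
        ultimately show "(m p j)\<^sup>2 / 2 + (m p' j)\<^sup>2 / 2 - (m p j - m p' j)\<^sup>2 / 4 \<le> 1" by linarith
      qed
      finally show "0 \<le> gY p p' \<and> gY p p' \<le> G / B\<^sup>2" using AB by (simp add: gY_def power2_eq_square divide_right_mono)
      show "\<bar>z p - z p'\<bar> \<le> 1 \<and> 0 \<le> s p p' \<and> s p p' \<le> 2" using zm pp by (simp add: s_def)
    qed (use K2 \<delta> in \<open>auto simp: q_def\<close>)
    then obtain SY where SY: "SY \<le> (G / B\<^sup>2) * K2 * (\<Sum>p\<in>Y. \<Sum>q\<in>Y. (max \<delta> (max \<bar>z p - z q\<bar> (s p q))) powr (- \<beta>))"
      "(\<lambda>n. (c n * q ^ n) * QY n) sums SY" by blast
    have "SY \<le> (G / B\<^sup>2) * K2 * (E * B\<^sup>2)"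
      using SY(1) EY K2 unfolding s_def by (elim order_trans, intro mult_left_mono) (auto simp: G_def)
    hence SY': "SY \<le> G * K2 * E" using AB by simp
    define R where "R = (\<lambda>p h. Re (1 / (1 - of_real q * cis (U p h))))"
    have geo: "(\<lambda>n. q ^ n * cos (real n * u)) sums Re (1 / (1 - of_real q * cis u))" for u
    proof -
      have "(\<lambda>n. (of_real q * cis u) ^ n) sums (1 / (1 - of_real q * cis u))"
        using q by (intro geometric_sums) (simp add: norm_mult)
      from sums_Re[OF this] show ?thesis
        by (simp add: power_mult_distrib Complex.DeMoivre flip: of_real_power)
    qed
    have Ssum: "(\<lambda>n. q ^ n * S n) sums (\<Sum>p\<in>X. \<Sum>h\<in>Y. (1 / A) * (1 / B) * R p h)"
    proof -
      have "(\<lambda>n. \<Sum>p\<in>X. \<Sum>h\<in>Y. (1 / A) * (1 / B) * (q ^ n * cos (real n * U p h)))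
        sums (\<Sum>p\<in>X. \<Sum>h\<in>Y. (1 / A) * (1 / B) * R p h)"
        unfolding R_def by (intro sums_sum sums_mult geo)
      thus ?thesis by (simp add: S_def sum_distrib_left mult_ac)
    qed
    have "2 * (\<Sum>p\<in>X. \<Sum>h\<in>Y. (1 / A) * (1 / B) * R p h) \<le> 2 + K1 * (SX + SY)"
    proof (rule sums_le)
      show "(\<lambda>n. 2 * (q ^ n * S n)) sums (2 * (\<Sum>p\<in>X. \<Sum>h\<in>Y. (1 / A) * (1 / B) * R p h))"
        by (intro sums_mult Ssum)
      have "(\<lambda>n. if n = 0 then (\<lambda>_. 2) n else (0::real)) sums 2" by (rule sums_single)
      thus "(\<lambda>n. (if n = 0 then 2 else 0) + K1 * ((c n * q ^ n) * QX n + (c n * q ^ n) * QY n)) sums (2 + K1 * (SX + SY))"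
        by (intro sums_add sums_mult SX SY)
      fix n
      have "q ^ n * (2 * S n) \<le> q ^ n * ((if n = 0 then 2 else 0) + K1 * (c n * QX n + c n * QY n))"
        using q step by (intro mult_left_mono) auto
      thus "2 * (q ^ n * S n) \<le> (if n = 0 then 2 else 0) + K1 * ((c n * q ^ n) * QX n + (c n * q ^ n) * QY n)"
        by (cases "n = 0") (simp_all add: algebra_simps)
    qed
    also have "\<dots> \<le> 2 + K1 * (G * K2 * E + G * K2 * E)" using SX' SY' K1 by (intro add_left_mono mult_left_mono add_mono) auto
    finally have "(\<Sum>p\<in>X. \<Sum>h\<in>Y. (1 / A) * (1 / B) * R p h) \<le> Q" by (simp add: Q_def algebra_simps)
    moreover have "(\<Sum>p\<in>X. \<Sum>h\<in>Y. (1 / A) * (1 / B) * R p h) = (\<Sum>(p, h)\<in>X \<times> Y. R p h) / (A * B)"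
      by (simp add: sum.cartesian_product sum_divide_distrib case_prod_unfold)
    ultimately have total: "(\<Sum>(p, h)\<in>X \<times> Y. R p h) \<le> Q * (A * B)" using AB by (simp add: pos_divide_le_eq)
    define I where "I = {(p, h). p \<in> X \<and> h \<in> Y \<and> \<bar>U p h\<bar> \<le> L * \<delta>}"
    have I: "I \<subseteq> X \<times> Y" by (auto simp: I_def)
    have "real (card I) * (1 / (2 * (1 + L)\<^sup>2 * \<delta>)) = (\<Sum>(p, h)\<in>I. 1 / (2 * (1 + L)\<^sup>2 * \<delta>))" by simp
    also have "\<dots> \<le> (\<Sum>(p, h)\<in>I. R p h)"
      unfolding R_def q_def by (intro sum_mono) (auto simp: I_def intro!: Re_inverse_one_minus_polar(2) \<delta> L)
    also have "\<dots> \<le> (\<Sum>(p, h)\<in>X \<times> Y. R p h)"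
      using fin I Re_inverse_one_minus_polar(1)[OF \<delta>] unfolding R_def q_def by (intro sum_mono2) auto
    also note total
    finally have "real (card I) \<le> Q * (A * B) * (2 * (1 + L)\<^sup>2 * \<delta>)"
      using \<delta> L by (simp add: pos_divide_le_eq)
    thus ?thesis by (simp add: I_def U_def K_def mult_ac)
  qed
  show ?thesis
    by (rule exI[of _ K], intro conjI allI impI K) (elim conjE, rule bound; assumption)
qed

section \<open>Separated sets and their energies\<close>

text \<open>Pigeonhole on a grid of mesh \<delta> / (card I + 1): two points in one cell differ by
  at most the mesh in each coordinate, so their distance is at most card I times the mesh, strictly
  below \<delta>. Abstract coordinates \<open>\<phi>\<close> serve points and hyperplanes
  alike.\<close>

lemma (in Metric_space) separated_card_le:
  fixes \<phi> :: "'i \<Rightarrow> 'a \<Rightarrow> real" and a :: "'i \<Rightarrow> real"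
  assumes sep: "separated \<delta> E" and \<delta>: "\<delta> > 0" and I: "finite I"
    and up: "\<And>x y. x \<in> M \<Longrightarrow> y \<in> M \<Longrightarrow> d x y \<le> (\<Sum>i\<in>I. \<bar>\<phi> i x - \<phi> i y\<bar>)"
    and R: "\<And>x i. x \<in> E \<Longrightarrow> i \<in> I \<Longrightarrow> \<bar>\<phi> i x - a i\<bar> \<le> R"
  shows "finite E" "card E \<le> nat (2 * \<lceil>R * real (card I + 1) / \<delta>\<rceil> + 1) ^ card I"
proof -
  define k where "k = real (card I + 1)"
  define N where "N = \<lceil>R * k / \<delta>\<rceil>"
  define f where "f = (\<lambda>x. \<lambda>i\<in>I. \<lfloor>(\<phi> i x - a i) * k / \<delta>\<rfloor>)"
  have k: "k > 0" by (simp add: k_def)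
  have f: "f ` E \<subseteq> (\<Pi>\<^sub>E i\<in>I. {- N..N})"
  proof
    fix y assume "y \<in> f ` E"
    then obtain x where x: "x \<in> E" "y = f x" by blast
    have "\<lfloor>(\<phi> i x - a i) * k / \<delta>\<rfloor> \<in> {- N..N}" if "i \<in> I" for i
    proof -
      have "\<bar>(\<phi> i x - a i) * k / \<delta>\<bar> = \<bar>\<phi> i x - a i\<bar> * k / \<delta>" using k \<delta> by (simp add: abs_mult)
      also have "\<dots> \<le> R * k / \<delta>" using R[OF x(1) that] k \<delta> by (intro divide_right_mono mult_right_mono) auto
      also have "\<dots> \<le> N" unfolding N_def by simp
      finally have "- real_of_int N \<le> (\<phi> i x - a i) * k / \<delta>" "(\<phi> i x - a i) * k / \<delta> \<le> real_of_int N" by linarith+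
      thus ?thesis by (simp add: le_floor_iff floor_le_iff)
    qed
    thus "y \<in> (\<Pi>\<^sub>E i\<in>I. {- N..N})" by (auto simp: x f_def)
  qed
  have inj: "inj_on f E"
  proof (rule inj_onI, rule ccontr)
    fix x y assume xy: "x \<in> E" "y \<in> E" "f x = f y" "x \<noteq> y"
    have M: "x \<in> M" "y \<in> M" "\<delta> \<le> d x y" using sep xy by (auto simp: separated_def)
    have "\<bar>\<phi> i x - \<phi> i y\<bar> \<le> \<delta> / k" if i: "i \<in> I" for i
    proof -
      have "\<lfloor>(\<phi> i x - a i) * k / \<delta>\<rfloor> = \<lfloor>(\<phi> i y - a i) * k / \<delta>\<rfloor>"
        using fun_cong[OF xy(3), of i] i by (simp add: f_def)
      hence "\<bar>(\<phi> i x - a i) * k / \<delta> - (\<phi> i y - a i) * k / \<delta>\<bar> \<le> 1" by linarith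
      also have "(\<phi> i x - a i) * k / \<delta> - (\<phi> i y - a i) * k / \<delta> = (\<phi> i x - \<phi> i y) * k / \<delta>"
        by (simp add: algebra_simps diff_divide_distrib)
      finally have "\<bar>\<phi> i x - \<phi> i y\<bar> * k / \<delta> \<le> 1" using k \<delta> by (simp add: abs_mult)
      thus ?thesis using k \<delta> by (simp only: pos_divide_le_eq pos_le_divide_eq mult_1_left)
    qed
    hence "(\<Sum>i\<in>I. \<bar>\<phi> i x - \<phi> i y\<bar>) \<le> (\<Sum>i\<in>I. \<delta> / k)" by (intro sum_mono)
    also have "\<dots> < \<delta>" using \<delta> by (simp add: k_def field_simps)
    finally show False using up[OF M(1,2)] M(3) by linarith
  qed
  have fin: "finite (\<Pi>\<^sub>E i\<in>I. {- N..N})" using I by (intro finite_PiE) auto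
  show "finite E" using finite_subset[OF f fin] inj finite_image_iff by blast
  have "card E = card (f ` E)" using inj by (simp add: card_image)
  also have "\<dots> \<le> card (\<Pi>\<^sub>E i\<in>I. {- N..N})" by (intro card_mono fin f)
  also have "\<dots> = nat (2 * N + 1) ^ card I" using I by (simp add: card_PiE)
  finally show "card E \<le> nat (2 * \<lceil>R * real (card I + 1) / \<delta>\<rceil> + 1) ^ card I"
    by (simp only: N_def k_def)
qed

text \<open>The balls about the points of a finite set cover it, so the infimum runs over a nonempty
  set of naturals and is a minimum.\<close>

lemma (in Metric_space) covering_number_attained:
  assumes "finite A" "A \<subseteq> M" "\<delta> \<ge> 0"
  shows "\<exists>F. finite F \<and> F \<subseteq> M \<and> A \<subseteq> (\<Union>x\<in>F. mcball x \<delta>) \<and> covering_number \<delta> A = enat (card F)"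
    and "covering_number \<delta> A \<le> enat (card A)"
proof -
  define \<F> where "\<F> = {F. finite F \<and> F \<subseteq> M \<and> A \<subseteq> (\<Union>x\<in>F. mcball x \<delta>)}"
  have A: "A \<in> \<F>" using assms by (force simp: \<F>_def in_mcball)
  hence "Inf ((\<lambda>F. enat (card F)) ` \<F>) \<in> (\<lambda>F. enat (card F)) ` \<F>"
    by (intro wellorder_InfI[of "enat (card A)"]) auto
  thus "\<exists>F. finite F \<and> F \<subseteq> M \<and> A \<subseteq> (\<Union>x\<in>F. mcball x \<delta>) \<and> covering_number \<delta> A = enat (card F)"
    unfolding covering_number_def \<F>_def by auto
  show "covering_number \<delta> A \<le> enat (card A)"
    unfolding covering_number_def using A by (intro INF_lower) (simp add: \<F>_def)
qed

text \<open>Covering numbers are traded for cardinalities. A ball of radius \<delta> holds boundedly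
  many points of a separated set, so the number of points in a larger ball is at most a constant
  times its covering number; on the right-hand side the covering number of \<open>E\<close> is at
  most \<open>card E\<close>.\<close>

lemma (in Metric_space) delta_set_card_le:
  fixes \<phi> :: "'i \<Rightarrow> 'a \<Rightarrow> real"
  assumes sep: "separated \<delta> E" and E: "delta_set \<delta> s C E" and I: "finite I"
    and up: "\<And>x y. x \<in> M \<Longrightarrow> y \<in> M \<Longrightarrow> d x y \<le> (\<Sum>i\<in>I. \<bar>\<phi> i x - \<phi> i y\<bar>)"
    and lip: "\<And>i x y. i \<in> I \<Longrightarrow> x \<in> M \<Longrightarrow> y \<in> M \<Longrightarrow> \<bar>\<phi> i x - \<phi> i y\<bar> \<le> d x y"
  shows "finite E"
    and "\<And>r x. \<delta> \<le> r \<Longrightarrow> r \<le> 1 \<Longrightarrow> x \<in> M \<Longrightarrow>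
      real (card (E \<inter> mcball x r)) \<le> (2 * real (card I) + 3) ^ card I * C * r powr s * real (card E)"
proof -
  have \<delta>: "\<delta> > 0" and EM: "E \<subseteq> M" and C: "C > 0" using E sep by (auto simp: delta_set_def separated_def)
  obtain c B where cB: "E \<subseteq> mcball c B" using E by (auto simp: delta_set_def mbounded_def)
  show fin: "finite E"
  proof (rule separated_card_le(1)[OF sep \<delta> I up])
    fix x i assume "x \<in> E" "i \<in> I"
    thus "\<bar>\<phi> i x - \<phi> i c\<bar> \<le> B" using lip[of i x c] cB by (auto simp: in_mcball commute)
  qed
  have ball: "real (card (E \<inter> mcball x \<delta>)) \<le> (2 * real (card I) + 3) ^ card I" if x: "x \<in> M" for x
  proof -
    have sep': "separated \<delta> (E \<inter> mcball x \<delta>)" using sep by (auto simp: separated_def)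
    have "card (E \<inter> mcball x \<delta>) \<le> nat (2 * \<lceil>\<delta> * real (card I + 1) / \<delta>\<rceil> + 1) ^ card I"
    proof (rule separated_card_le(2)[OF sep' \<delta> I up])
      fix y i assume "y \<in> E \<inter> mcball x \<delta>" "i \<in> I"
      thus "\<bar>\<phi> i y - \<phi> i x\<bar> \<le> \<delta>" using lip[of i y x] by (auto simp: in_mcball commute)
    qed
    also have "nat (2 * \<lceil>\<delta> * real (card I + 1) / \<delta>\<rceil> + 1) = 2 * card I + 3"
    proof -
      have "\<lceil>\<delta> * real (card I + 1) / \<delta>\<rceil> = \<lceil>real (card I + 1)\<rceil>" using \<delta> by simp
      also have "\<dots> = int (card I + 1)" by (rule ceiling_of_nat)
      finally have "\<lceil>\<delta> * real (card I + 1) / \<delta>\<rceil> = int (card I + 1)" .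
      thus ?thesis by simp
    qed
    finally have "real (card (E \<inter> mcball x \<delta>)) \<le> real ((2 * card I + 3) ^ card I)" by (simp only: of_nat_le_iff)
    thus ?thesis by simp
  qed
  fix r x assume r: "\<delta> \<le> r" "r \<le> 1" and x: "x \<in> M"
  define A where "A = E \<inter> mcball x r"
  have "finite A" "A \<subseteq> M" using fin EM by (auto simp: A_def)
  then obtain F where F: "finite F" "F \<subseteq> M" "A \<subseteq> (\<Union>y\<in>F. mcball y \<delta>)" "covering_number \<delta> A = enat (card F)"
    using covering_number_attained(1)[of A \<delta>] \<delta> by auto
  have "ereal_of_enat (covering_number \<delta> A) \<le> ereal (C * r powr s) * ereal_of_enat (covering_number \<delta> E)"
    using E r x by (auto simp: delta_set_def A_def)
  also have "\<dots> \<le> ereal (C * r powr s) * ereal_of_enat (enat (card E))"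
  proof (rule ereal_mult_left_mono)
    show "ereal_of_enat (covering_number \<delta> E) \<le> ereal_of_enat (enat (card E))"
      using covering_number_attained(2)[OF fin EM] \<delta> by (simp only: ereal_of_enat_le_iff less_imp_le)
  qed (use C in simp)
  finally have cF: "real (card F) \<le> C * r powr s * real (card E)" by (simp add: F(4))
  have "A \<subseteq> (\<Union>y\<in>F. E \<inter> mcball y \<delta>)" using F(3) by (auto simp: A_def)
  hence "card A \<le> card (\<Union>y\<in>F. E \<inter> mcball y \<delta>)" using fin F(1) by (intro card_mono) auto
  also have "\<dots> \<le> (\<Sum>y\<in>F. card (E \<inter> mcball y \<delta>))" by (rule card_UN_le[OF F(1)])
  finally have "real (card A) \<le> (\<Sum>y\<in>F. real (card (E \<inter> mcball y \<delta>)))" by (simp flip: of_nat_sum)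
  also have "\<dots> \<le> (\<Sum>y\<in>F. (2 * real (card I) + 3) ^ card I)" using F(2) ball by (intro sum_mono) auto
  also have "\<dots> = (2 * real (card I) + 3) ^ card I * real (card F)" by simp
  also have "\<dots> \<le> (2 * real (card I) + 3) ^ card I * (C * r powr s * real (card E))"
    by (intro mult_left_mono cF) auto
  finally show "real (card (E \<inter> mcball x r)) \<le> (2 * real (card I) + 3) ^ card I * C * r powr s * real (card E)"
    by (simp add: A_def mult_ac)
qed

section \<open>Energies by dyadic decomposition\<close>

text \<open>If (1/2)^(j + 1) < v \<le> (1/2)^j, the summand for j alone dominates; the 1 covers v >
  1. Scales below \<delta> are left out because the ball bounds of a delta-set start at radius
  \<delta>.\<close>

lemma dyadic_bound:
  fixes \<delta> \<beta> v :: real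
  assumes \<delta>: "0 < \<delta>" and v: "\<delta> \<le> v" and \<beta>: "\<beta> > 0" and m: "(1/2) ^ m < \<delta>"
  shows "v powr (- \<beta>) \<le> 1 + (\<Sum>j\<in>{j. j < m \<and> \<delta> \<le> (1/2) ^ j}. 2 powr (real (j + 1) * \<beta>) * (if v \<le> (1/2) ^ j then 1 else 0))"
proof (cases "v > 1")
  case True
  have "v powr (- \<beta>) \<le> 1 powr (- \<beta>)" using True \<beta> by (intro powr_mono2') auto
  moreover have "0 \<le> (\<Sum>j\<in>{j. j < m \<and> \<delta> \<le> (1/2) ^ j}. 2 powr (real (j + 1) * \<beta>) * (if v \<le> (1/2) ^ j then 1 else 0))"
    by (intro sum_nonneg) auto
  ultimately show ?thesis by simp
next
  case False
  define n where "n = (LEAST n. (1/2) ^ n < v)"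
  have ex: "(1/2) ^ m < v" using m v by linarith
  have n: "(1/2) ^ n < v" unfolding n_def by (rule LeastI[of _ m]) (rule ex)
  have "n \<noteq> 0" using n False by (intro notI) simp
  then obtain j where j: "n = Suc j" by (cases n) auto
  have vj: "v \<le> (1/2) ^ j" using not_less_Least[of j "\<lambda>n. (1/2) ^ n < v"] j unfolding n_def by force
  have "n \<le> m" unfolding n_def by (rule Least_le) (rule ex)
  hence jm: "j \<in> {j. j < m \<and> \<delta> \<le> (1/2) ^ j}" using j vj v by auto
  have "v powr (- \<beta>) \<le> ((1/2) ^ (j + 1)) powr (- \<beta>)"
    using n j \<beta> by (intro powr_mono2') auto
  also have "\<dots> = 2 powr (real (j + 1) * \<beta>)"
  proof -
    have "(1/2::real) ^ (j + 1) = 2 powr (- real (j + 1))"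
      by (simp add: powr_minus powr_realpow power_one_over inverse_eq_divide del: of_nat_add of_nat_Suc power_Suc)
    thus ?thesis by (simp only: powr_powr minus_mult_minus)
  qed
  also have "\<dots> = 2 powr (real (j + 1) * \<beta>) * (if v \<le> (1/2) ^ j then 1 else 0)" using vj by simp
  also have "\<dots> \<le> (\<Sum>j\<in>{j. j < m \<and> \<delta> \<le> (1/2) ^ j}. 2 powr (real (j + 1) * \<beta>) * (if v \<le> (1/2) ^ j then 1 else 0))"
    by (rule member_le_sum[OF jm]) auto
  finally show ?thesis by simp
qed

text \<open>At scale 2^(-j) the weight 2^((j + 1) \<beta>) meets at most A 2^(-j s) card E points.
  The products form a geometric series of ratio 2^(\<beta> - s) < 1, so the bound is uniform in
  \<delta>; at \<beta> = s this estimate would grow with the number of scales.\<close>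

lemma energy_sum_le:
  fixes f :: "'a \<Rightarrow> real"
  assumes E: "finite E" and \<delta>: "0 < \<delta>" "\<delta> \<le> 1" and \<beta>: "0 < \<beta>" "\<beta> < s" and A: "A \<ge> 0"
    and ball: "\<And>r. \<delta> \<le> r \<Longrightarrow> r \<le> 1 \<Longrightarrow> real (card {y\<in>E. f y \<le> r}) \<le> A * r powr s * real (card E)"
  shows "(\<Sum>y\<in>E. (max \<delta> (f y)) powr (- \<beta>)) \<le> (1 + A * 2 powr \<beta> / (1 - 2 powr (\<beta> - s))) * real (card E)"
proof -
  obtain m where m: "(1/2) ^ m < \<delta>" using real_arch_pow_inv[OF \<delta>(1), of "1/2"] by auto
  define J where "J = {j. j < m \<and> \<delta> \<le> (1/2) ^ j}"
  have J: "finite J" by (simp add: J_def)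
  define \<rho> where "\<rho> = (2::real) powr (\<beta> - s)"
  have \<rho>: "0 < \<rho>" "\<rho> < 1" using \<beta> by (auto simp: \<rho>_def powr_less_one)
  have "(\<Sum>y\<in>E. (max \<delta> (f y)) powr (- \<beta>))
     \<le> (\<Sum>y\<in>E. 1 + (\<Sum>j\<in>J. 2 powr (real (j + 1) * \<beta>) * (if max \<delta> (f y) \<le> (1/2) ^ j then 1 else 0)))"
    unfolding J_def by (intro sum_mono dyadic_bound \<delta> \<beta> m) simp
  also have "\<dots> = real (card E) + (\<Sum>j\<in>J. 2 powr (real (j + 1) * \<beta>) * (\<Sum>y\<in>E. if max \<delta> (f y) \<le> (1/2) ^ j then 1 else 0))"
    by (simp add: sum.distrib sum.swap[of _ E] sum_distrib_left)
  also have "(\<Sum>j\<in>J. 2 powr (real (j + 1) * \<beta>) * (\<Sum>y\<in>E. if max \<delta> (f y) \<le> (1/2) ^ j then 1 else 0))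
     \<le> (\<Sum>j\<in>J. A * 2 powr \<beta> * real (card E) * \<rho> ^ j)"
  proof (rule sum_mono)
    fix j assume j: "j \<in> J"
    have "(\<Sum>y\<in>E. if max \<delta> (f y) \<le> (1/2) ^ j then 1 else 0) = real (card {y\<in>E. f y \<le> (1/2) ^ j})"
      using E j by (simp add: J_def sum.If_cases Int_def)
    also have "\<dots> \<le> A * ((1/2) ^ j) powr s * real (card E)"
      using j by (intro ball) (auto simp: J_def power_le_one)
    finally have "2 powr (real (j + 1) * \<beta>) * (\<Sum>y\<in>E. if max \<delta> (f y) \<le> (1/2) ^ j then 1 else 0)
      \<le> 2 powr (real (j + 1) * \<beta>) * (A * ((1/2) ^ j) powr s * real (card E))"
      by (intro mult_left_mono) auto
    also have "\<dots> = A * 2 powr \<beta> * real (card E) * (2 powr (real j * \<beta>) * ((1/2) ^ j) powr s)"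
      by (simp add: algebra_simps powr_add)
    also have "2 powr (real j * \<beta>) * ((1/2) ^ j) powr s = \<rho> ^ j"
    proof -
      have "(1/2::real) ^ j = 2 powr (- real j)"
        by (simp add: powr_minus powr_realpow power_one_over inverse_eq_divide)
      hence "2 powr (real j * \<beta>) * ((1/2) ^ j) powr s = 2 powr (real j * \<beta> + - real j * s)"
        by (simp only: powr_powr powr_add)
      also have "real j * \<beta> + - real j * s = (\<beta> - s) * real j" by (simp add: algebra_simps)
      also have "2 powr \<dots> = \<rho> powr real j" by (simp add: \<rho>_def powr_powr)
      also have "\<dots> = \<rho> ^ j" using \<rho> by (simp add: powr_realpow)
      finally show ?thesis .
    qed
    finally show "2 powr (real (j + 1) * \<beta>) * (\<Sum>y\<in>E. if max \<delta> (f y) \<le> (1/2) ^ j then 1 else 0)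
      \<le> A * 2 powr \<beta> * real (card E) * \<rho> ^ j" .
  qed
  also have "\<dots> = A * 2 powr \<beta> * real (card E) * (\<Sum>j\<in>J. \<rho> ^ j)" by (simp add: sum_distrib_left)
  also have "\<dots> \<le> A * 2 powr \<beta> * real (card E) * (1 / (1 - \<rho>))"
  proof (intro mult_left_mono)
    have "(\<Sum>j\<in>J. \<rho> ^ j) \<le> (\<Sum>j. \<rho> ^ j)" using \<rho> J by (intro sum_le_suminf) auto
    also have "\<dots> = 1 / (1 - \<rho>)" using \<rho> by (intro suminf_geometric) auto
    finally show "(\<Sum>j\<in>J. \<rho> ^ j) \<le> 1 / (1 - \<rho>)" .
  qed (use A in auto)
  finally show ?thesis by (simp add: \<rho>_def algebra_simps)
qed

text \<open>The kernel \<open>k\<close> is compared with the metric only on \<open>F\<close>; after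
  the comparison the sums are extended to \<open>E\<close>, where the ball counts hold. Thus a part
  of a delta-set inherits the energy bound relative to the size of the whole.\<close>

lemma (in Metric_space) delta_set_energy_le:
  fixes \<phi> :: "'i \<Rightarrow> 'a \<Rightarrow> real"
  assumes sep: "separated \<delta> E" and E: "delta_set \<delta> s C E" and I: "finite I"
    and up: "\<And>x y. x \<in> M \<Longrightarrow> y \<in> M \<Longrightarrow> d x y \<le> (\<Sum>i\<in>I. \<bar>\<phi> i x - \<phi> i y\<bar>)"
    and lip: "\<And>i x y. i \<in> I \<Longrightarrow> x \<in> M \<Longrightarrow> y \<in> M \<Longrightarrow> \<bar>\<phi> i x - \<phi> i y\<bar> \<le> d x y"
    and \<beta>: "0 < \<beta>" "\<beta> < s" and F: "F \<subseteq> E" and \<kappa>: "\<kappa> > 0"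
    and k: "\<And>x y. x \<in> F \<Longrightarrow> y \<in> F \<Longrightarrow> \<kappa> * max \<delta> (d x y) \<le> k x y"
  shows "(\<Sum>x\<in>F. \<Sum>y\<in>F. k x y powr (- \<beta>))
    \<le> \<kappa> powr (- \<beta>) * (1 + (2 * real (card I) + 3) ^ card I * C * 2 powr \<beta> / (1 - 2 powr (\<beta> - s))) * (real (card E))\<^sup>2"
proof -
  have \<delta>: "0 < \<delta>" "\<delta> \<le> 1" and EM: "E \<subseteq> M" and C: "C > 0" using E sep by (auto simp: delta_set_def separated_def)
  have fin: "finite E" by (rule delta_set_card_le(1)[OF sep E I up lip])
  define Q where "Q = 1 + (2 * real (card I) + 3) ^ card I * C * 2 powr \<beta> / (1 - 2 powr (\<beta> - s))"
  have sum_le: "(\<Sum>y\<in>F. k x y powr (- \<beta>)) \<le> \<kappa> powr (- \<beta>) * (Q * real (card E))" if x: "x \<in> F" for x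
  proof -
    have xM: "x \<in> M" using x F EM by auto
    have "(\<Sum>y\<in>F. k x y powr (- \<beta>)) \<le> (\<Sum>y\<in>F. \<kappa> powr (- \<beta>) * (max \<delta> (d x y)) powr (- \<beta>))"
    proof (rule sum_mono)
      fix y assume y: "y \<in> F"
      have pos: "max \<delta> (d x y) > 0" using \<delta> by simp
      have "k x y powr (- \<beta>) \<le> (\<kappa> * max \<delta> (d x y)) powr (- \<beta>)"
        using k[OF x y] \<kappa> pos \<beta> by (intro powr_mono2') auto
      thus "k x y powr (- \<beta>) \<le> \<kappa> powr (- \<beta>) * (max \<delta> (d x y)) powr (- \<beta>)"
        by (simp only: powr_mult)
    qed
    also have "\<dots> \<le> (\<Sum>y\<in>E. \<kappa> powr (- \<beta>) * (max \<delta> (d x y)) powr (- \<beta>))"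
      using F fin by (intro sum_mono2) auto
    also have "\<dots> = \<kappa> powr (- \<beta>) * (\<Sum>y\<in>E. (max \<delta> (d x y)) powr (- \<beta>))" by (simp add: sum_distrib_left)
    also have "\<dots> \<le> \<kappa> powr (- \<beta>) * (Q * real (card E))"
      unfolding Q_def
    proof (intro mult_left_mono energy_sum_le fin \<delta> \<beta>)
      fix r assume r: "\<delta> \<le> r" "r \<le> 1"
      have "{y \<in> E. d x y \<le> r} = E \<inter> mcball x r" using EM xM by (auto simp: in_mcball)
      thus "real (card {y \<in> E. d x y \<le> r}) \<le> (2 * real (card I) + 3) ^ card I * C * r powr s * real (card E)"
        using delta_set_card_le(2)[OF sep E I up lip _ _ xM] r by simp
    qed (use C in auto)
    finally show ?thesis .
  qed
  have Q: "Q \<ge> 0" unfolding Q_def using \<beta> C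
    by (intro add_nonneg_nonneg divide_nonneg_nonneg mult_nonneg_nonneg) (auto intro!: less_imp_le[OF powr_less_one])
  have "(\<Sum>x\<in>F. \<Sum>y\<in>F. k x y powr (- \<beta>)) \<le> (\<Sum>x\<in>F. \<kappa> powr (- \<beta>) * (Q * real (card E)))"
    by (intro sum_mono sum_le)
  also have "\<dots> \<le> (\<Sum>x\<in>E. \<kappa> powr (- \<beta>) * (Q * real (card E)))"
    using F fin Q by (intro sum_mono2) auto
  finally show ?thesis unfolding Q_def[symmetric] by (simp add: power2_eq_square mult_ac)
qed

section \<open>Coordinates of hyperplanes\<close>

lemma hyperplane_normal_form:
  fixes V :: "(real ^ 'n) set"
  assumes "V \<in> hyperplanes"
  shows "\<exists>a b i. a $ i = 1 \<and> (\<forall>j. \<bar>a $ j\<bar> \<le> 1) \<and> V = {x. a \<bullet> x = b}"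
proof -
  have V: "affine V" "aff_dim V = int DIM(real ^ 'n) - 1" using assms by (auto simp: hyperplanes_def)
  have "aff_dim V = int (DIM(real ^ 'n) - 1)" using V(2) DIM_positive[where 'a = "real ^ 'n"] by (simp add: of_nat_diff)
  then obtain a b where a: "a \<noteq> 0" "affine hull V = {x. a \<bullet> x = b}"
    unfolding aff_dim_eq_hyperplane by blast
  have "finite (range (\<lambda>j. \<bar>a $ j\<bar>))" "range (\<lambda>j. \<bar>a $ j\<bar>) \<noteq> {}" by auto
  then obtain i where i: "\<bar>a $ i\<bar> = Max (range (\<lambda>j. \<bar>a $ j\<bar>))" using Max_in by (metis (no_types, lifting) imageE)
  have le: "\<bar>a $ j\<bar> \<le> \<bar>a $ i\<bar>" for j unfolding i by (intro Max_ge) auto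
  have ai: "a $ i \<noteq> 0"
  proof
    assume "a $ i = 0"
    hence "a = 0" using le by (simp add: vec_eq_iff)
    thus False using a by simp
  qed
  define e where "e = a /\<^sub>R (a $ i)"
  have "e $ i = 1" using ai by (simp add: e_def)
  moreover have "\<bar>e $ j\<bar> \<le> 1" for j
    using le[of j] ai by (simp add: e_def abs_mult field_simps)
  moreover have "V = {x. e \<bullet> x = b / a $ i}"
  proof -
    have "V = {x. a \<bullet> x = b}" using a(2) affine_hull_eq[of V] V(1) by blast
    thus ?thesis using ai by (auto simp: e_def field_simps)
  qed
  ultimately show ?thesis by blast
qed

lemma
  fixes a :: "'a::euclidean_space"
  assumes a: "a \<noteq> 0" and V: "V = {x. a \<bullet> x = b}"
  shows orth_proj_direction_hyperplane: "orth_proj (direction V) x = x - (a \<bullet> x) *\<^sub>R (a /\<^sub>R (a \<bullet> a))"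
    and offset_hyperplane: "offset V = b *\<^sub>R (a /\<^sub>R (a \<bullet> a))"
proof -
  define S where "S = {x. a \<bullet> x = 0}"
  define c where "c = b *\<^sub>R (a /\<^sub>R (a \<bullet> a))"
  have S: "subspace S" unfolding S_def by (rule subspace_hyperplane)
  have aa: "a \<bullet> a \<noteq> 0" using a by simp
  have ac: "a \<bullet> c = b" using aa by (simp add: c_def)
  have comp: "t *\<^sub>R (a /\<^sub>R (a \<bullet> a)) \<in> S\<^sup>\<bottom>" for t
    by (auto simp: orthogonal_comp_def S_def orthogonal_def inner_commute)
  have VS: "V = (+) c ` S"
  proof (intro equalityI subsetI)
    fix x assume "x \<in> V"
    hence "x - c \<in> S" using ac by (simp add: V S_def inner_diff_right)
    moreover have "x = c + (x - c)" by simp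
    ultimately show "x \<in> (+) c ` S" by blast
  next
    fix x assume "x \<in> (+) c ` S"
    thus "x \<in> V" using ac by (auto simp: V S_def inner_add_right)
  qed
  have dir: "direction V = S" unfolding VS by (rule direction_translation[OF S])
  show "offset V = b *\<^sub>R (a /\<^sub>R (a \<bullet> a))"
    unfolding VS c_def by (rule offset_translation[OF S comp])
  show "orth_proj (direction V) x = x - (a \<bullet> x) *\<^sub>R (a /\<^sub>R (a \<bullet> a))"
    unfolding dir
  proof (rule orth_proj_unique[OF S])
    show "x - (a \<bullet> x) *\<^sub>R (a /\<^sub>R (a \<bullet> a)) \<in> S" using aa by (simp add: S_def inner_diff_right)
    show "x - (x - (a \<bullet> x) *\<^sub>R (a /\<^sub>R (a \<bullet> a))) \<in> S\<^sup>\<bottom>" using comp[of "a \<bullet> x"] by simp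
  qed
qed

text \<open>The map a / |a|^2 is inversion in the unit sphere. It multiplies the distance of a and
  a' by 1 / (|a| |a'|), so it does not increase distances outside the open unit ball.\<close>

lemma norm_inversion_diff_le:
  fixes a a' :: "'a::real_inner"
  assumes "norm a \<ge> 1" "norm a' \<ge> 1"
  shows "norm (a /\<^sub>R (a \<bullet> a) - a' /\<^sub>R (a' \<bullet> a')) \<le> norm (a - a')"
proof -
  define A A' where "A = a \<bullet> a" and "A' = a' \<bullet> a'"
  have A: "A \<ge> 1" "A' \<ge> 1" using assms by (simp_all add: A_def A'_def flip: power2_norm_eq_inner)
  have 1: "(norm (a /\<^sub>R A - a' /\<^sub>R A'))\<^sup>2 * (A * A') = (norm (a - a'))\<^sup>2"
  proof -
    have "(norm (a /\<^sub>R A - a' /\<^sub>R A'))\<^sup>2 = A / A\<^sup>2 - 2 * (a \<bullet> a') / (A * A') + A' / A'\<^sup>2"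
      unfolding power2_norm_eq_inner
      by (simp add: inner_diff inner_commute[of a' a] A_def[symmetric] A'_def[symmetric] divide_inverse power2_eq_square)
        (simp add: algebra_simps)
    hence "(norm (a /\<^sub>R A - a' /\<^sub>R A'))\<^sup>2 * (A * A') = A' - 2 * (a \<bullet> a') + A"
      using A by (simp add: power2_eq_square field_simps)
    also have "\<dots> = (norm (a - a'))\<^sup>2"
      by (simp add: power2_norm_eq_inner inner_diff inner_commute[of a' a] A_def A'_def)
    finally show ?thesis .
  qed
  have "1 * 1 \<le> A * A'" using A by (intro mult_mono) auto
  hence "(norm (a /\<^sub>R A - a' /\<^sub>R A'))\<^sup>2 * 1 \<le> (norm (a /\<^sub>R A - a' /\<^sub>R A'))\<^sup>2 * (A * A')"
    by (intro mult_left_mono) auto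
  hence "(norm (a /\<^sub>R A - a' /\<^sub>R A'))\<^sup>2 \<le> (norm (a - a'))\<^sup>2" by (simp add: 1)
  thus ?thesis unfolding A_def A'_def by (rule power2_le_imp_le) simp
qed

text \<open>Close coefficients force close hyperplanes, so an energy in the coefficients is
  dominated by one in the metric. Projection and offset are both expressed by a / (a \<bullet> a),
  which has norm at most 1 and depends on a in a 1-Lipschitz way; \<open>D\<close> bounds the
  remaining factors.\<close>

lemma hyperplane_dist_le:
  fixes a a' :: "'a::euclidean_space"
  assumes a: "norm a \<ge> 1" "norm a \<le> D" and a': "norm a' \<ge> 1" and b': "\<bar>b'\<bar> \<le> D"
    and V: "V = {x. a \<bullet> x = b}" and W: "W = {x. a' \<bullet> x = b'}"
  shows "hyperplane_dist V W \<le> (1 + 2 * D) * (norm (a - a') + \<bar>b - b'\<bar>)"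
proof -
  define g g' where "g = a /\<^sub>R (a \<bullet> a)" and "g' = a' /\<^sub>R (a' \<bullet> a')"
  have gg: "norm (g - g') \<le> norm (a - a')" unfolding g_def g'_def by (rule norm_inversion_diff_le[OF a(1) a'])
  have unit: "norm (e /\<^sub>R (e \<bullet> e)) \<le> 1" if "norm e \<ge> 1" for e :: 'a
  proof -
    have "norm (e /\<^sub>R (e \<bullet> e)) = inverse (norm e)"
    proof -
      have "norm e \<noteq> 0" using that by linarith
      thus ?thesis unfolding power2_norm_eq_inner[symmetric] norm_scaleR by (simp add: power2_eq_square)
    qed
    thus ?thesis using that by (simp add: inverse_le_1_iff)
  qed
  have g: "norm g \<le> 1" "norm g' \<le> 1" using unit a a' by (auto simp: g_def g'_def)
  have D: "D \<ge> 1" using a by linarith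
  have nz: "a \<noteq> 0" "a' \<noteq> 0" using a a' by auto
  have "onorm (\<lambda>x. orth_proj (direction V) x - orth_proj (direction W) x) \<le> (1 + D) * norm (a - a')"
  proof (rule onorm_le)
    fix x
    have "orth_proj (direction V) x - orth_proj (direction W) x = ((a' - a) \<bullet> x) *\<^sub>R g' - (a \<bullet> x) *\<^sub>R (g - g')"
      unfolding orth_proj_direction_hyperplane[OF nz(1) V] orth_proj_direction_hyperplane[OF nz(2) W] g_def[symmetric] g'_def[symmetric]
      by (simp add: inner_diff_left algebra_simps)
    also have "norm \<dots> \<le> norm (((a' - a) \<bullet> x) *\<^sub>R g') + norm ((a \<bullet> x) *\<^sub>R (g - g'))" by (rule norm_triangle_ineq4)
    also have "\<dots> \<le> (norm (a - a') * norm x) * 1 + (D * norm x) * norm (a - a')"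
    proof (intro add_mono)
      have "\<bar>(a' - a) \<bullet> x\<bar> \<le> norm (a - a') * norm x"
        using Cauchy_Schwarz_ineq2[of "a' - a" x] by (simp add: norm_minus_commute)
      thus "norm (((a' - a) \<bullet> x) *\<^sub>R g') \<le> (norm (a - a') * norm x) * 1"
        unfolding norm_scaleR using g by (intro mult_mono) auto
      have "\<bar>a \<bullet> x\<bar> \<le> norm a * norm x" by (rule Cauchy_Schwarz_ineq2)
      also have "\<dots> \<le> D * norm x" using a by (intro mult_right_mono) auto
      finally show "norm ((a \<bullet> x) *\<^sub>R (g - g')) \<le> (D * norm x) * norm (a - a')"
        unfolding norm_scaleR using gg D by (intro mult_mono) auto
    qed
    finally show "norm (orth_proj (direction V) x - orth_proj (direction W) x) \<le> (1 + D) * norm (a - a') * norm x"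
      by (simp add: algebra_simps)
  qed
  moreover have "norm (offset V - offset W) \<le> \<bar>b - b'\<bar> + D * norm (a - a')"
  proof -
    have "offset V - offset W = (b - b') *\<^sub>R g + b' *\<^sub>R (g - g')"
      unfolding offset_hyperplane[OF nz(1) V] offset_hyperplane[OF nz(2) W] g_def[symmetric] g'_def[symmetric]
      by (simp add: algebra_simps)
    also have "norm \<dots> \<le> norm ((b - b') *\<^sub>R g) + norm (b' *\<^sub>R (g - g'))" by (rule norm_triangle_ineq)
    also have "\<dots> \<le> \<bar>b - b'\<bar> * 1 + D * norm (a - a')"
      unfolding norm_scaleR using g gg b' D by (intro add_mono mult_mono) auto
    finally show ?thesis by simp
  qed
  ultimately have "hyperplane_dist V W \<le> (1 + 2 * D) * norm (a - a') + \<bar>b - b'\<bar>"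
    unfolding hyperplane_dist_def by (simp add: algebra_simps)
  also have "\<dots> \<le> (1 + 2 * D) * norm (a - a') + (1 + 2 * D) * \<bar>b - b'\<bar>"
    using D mult_right_mono[of 1 "1 + 2 * D" "\<bar>b - b'\<bar>"] by simp
  finally show ?thesis by (simp add: distrib_left)
qed

text \<open>Coordinates that require no choice of a normal vector: \<open>None\<close> selects the
  offset, \<open>Some e\<close> the projection of a basis vector. They serve the packing bound,
  where their number affects only constants; the energies use slopes and intercepts instead.\<close>

definition hyperplane_coord :: "(real ^ 'n) option \<times> 'n \<Rightarrow> (real ^ 'n) set \<Rightarrow> real" where
  "hyperplane_coord i V = (case fst i of None \<Rightarrow> offset V | Some e \<Rightarrow> orth_proj (direction V) e) $ snd i"

lemma hyperplane_coord_lipschitz: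
  fixes V W :: "(real ^ 'n) set"
  assumes "i \<in> insert None (Some ` Basis) \<times> UNIV"
  shows "\<bar>hyperplane_coord i V - hyperplane_coord i W\<bar> \<le> hyperplane_dist V W"
proof -
  define T where "T = (\<lambda>x. orth_proj (direction V) x - orth_proj (direction W) x)"
  have T: "bounded_linear T" unfolding T_def by (rule bounded_linear_orth_proj_diff)
  obtain k j where i: "i = (k, j)" by (cases i)
  show ?thesis
  proof (cases k)
    case None
    have "\<bar>hyperplane_coord i V - hyperplane_coord i W\<bar> = \<bar>(offset V - offset W) $ j\<bar>"
      by (simp add: hyperplane_coord_def i None)
    also have "\<dots> \<le> norm (offset V - offset W)" by (rule component_le_norm_cart)
    also have "\<dots> \<le> hyperplane_dist V W"
      unfolding hyperplane_dist_def using onorm_pos_le[OF T] by (simp add: T_def)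
    finally show ?thesis .
  next
    case (Some e)
    hence e: "norm e = 1" using assms i by auto
    have "\<bar>hyperplane_coord i V - hyperplane_coord i W\<bar> = \<bar>T e $ j\<bar>"
      by (simp add: hyperplane_coord_def i Some T_def)
    also have "\<dots> \<le> norm (T e)" by (rule component_le_norm_cart)
    also have "\<dots> \<le> onorm T" using onorm[OF T, of e] e by simp
    also have "\<dots> \<le> hyperplane_dist V W" unfolding hyperplane_dist_def T_def by simp
    finally show ?thesis .
  qed
qed

lemma hyperplane_dist_le_coord:
  fixes V W :: "(real ^ 'n) set"
  shows "hyperplane_dist V W
    \<le> (\<Sum>i\<in>insert None (Some ` Basis) \<times> UNIV. \<bar>hyperplane_coord i V - hyperplane_coord i W\<bar>)"
proof -
  define T where "T = (\<lambda>x. orth_proj (direction V) x - orth_proj (direction W) x)"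
  have T: "bounded_linear T" unfolding T_def by (rule bounded_linear_orth_proj_diff)
  have "onorm T \<le> (\<Sum>e\<in>Basis. norm (T e))" by (rule onorm_componentwise[OF T])
  also have "\<dots> \<le> (\<Sum>e\<in>Basis. \<Sum>j\<in>UNIV. \<bar>T e $ j\<bar>)" by (intro sum_mono norm_le_l1_cart)
  finally have "onorm T \<le> (\<Sum>e\<in>Basis. \<Sum>j\<in>UNIV. \<bar>T e $ j\<bar>)" .
  moreover have "norm (offset V - offset W) \<le> (\<Sum>j\<in>UNIV. \<bar>(offset V - offset W) $ j\<bar>)"
    by (rule norm_le_l1_cart)
  moreover have "(\<Sum>i\<in>insert None (Some ` Basis) \<times> UNIV. \<bar>hyperplane_coord i V - hyperplane_coord i W\<bar>)
    = (\<Sum>j\<in>UNIV. \<bar>(offset V - offset W) $ j\<bar>) + (\<Sum>e\<in>Basis. \<Sum>j\<in>UNIV. \<bar>T e $ j\<bar>)"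
    by (simp add: hyperplane_coord_def T_def sum.reindex sum.cartesian_product' del: insert_Times_insert)
  ultimately show ?thesis unfolding hyperplane_dist_def T_def by linarith
qed

lemma L2_set_remove_le:
  fixes v :: "real ^ 'n"
  shows "L2_set (\<lambda>j. v $ j) (UNIV - {i}) \<le> norm v"
    and "norm v \<le> \<bar>v $ i\<bar> + L2_set (\<lambda>j. v $ j) (UNIV - {i})"
proof -
  have "norm v = L2_set (\<lambda>j. v $ j) (insert i (UNIV - {i}))"
    by (simp add: norm_vec_def L2_set_def insert_absorb)
  hence eq: "norm v = sqrt ((v $ i)\<^sup>2 + (L2_set (\<lambda>j. v $ j) (UNIV - {i}))\<^sup>2)"
    by (subst (asm) L2_set_insert) auto
  show "L2_set (\<lambda>j. v $ j) (UNIV - {i}) \<le> norm v"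
    unfolding eq by (intro real_le_rsqrt) simp
  show "norm v \<le> \<bar>v $ i\<bar> + L2_set (\<lambda>j. v $ j) (UNIV - {i})"
    unfolding eq using sqrt_sum_squares_le_sum_abs[of "v $ i" "L2_set (\<lambda>j. v $ j) (UNIV - {i})"]
    by simp
qed

lemma nbhd_hyperplane_abs_le:
  fixes a :: "'a::euclidean_space"
  assumes V: "V = {x. a \<bullet> x = b}" and p: "p \<in> nbhd V r" and ne: "V \<noteq> {}"
  shows "\<bar>a \<bullet> p - b\<bar> \<le> norm a * r"
proof -
  \<comment> \<open>Nonemptiness matters here, since \<open>infdist\<close> to the empty set is 0 by
    convention.\<close>
  have "closed V" unfolding V by (rule closed_hyperplane)
  then obtain y where y: "a \<bullet> y = b" "infdist p V = dist p y"
    using infdist_attains_inf[of V p] ne unfolding V by auto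
  have "\<bar>a \<bullet> p - b\<bar> = \<bar>a \<bullet> (p - y)\<bar>" using y by (simp add: inner_diff_right)
  also have "\<dots> \<le> norm a * norm (p - y)" by (rule Cauchy_Schwarz_ineq2)
  also have "\<dots> \<le> norm a * r" using p y by (intro mult_left_mono) (auto simp: nbhd_def dist_norm)
  finally show ?thesis .
qed

section \<open>From hyperplane coefficients to incidences\<close>

text \<open>The bound on the components caps the slopes once the equation is solved for coordinate
  \<open>i\<close>. A normal with several largest components puts its hyperplane into several
  classes, so these form a cover and not a partition.\<close>

definition steep_hyperplanes :: "'n::finite \<Rightarrow> (real ^ 'n) set set" where
  "steep_hyperplanes i = {V. \<exists>a b. a $ i = 1 \<and> (\<forall>j. \<bar>a $ j\<bar> \<le> 1) \<and> V = {x. a \<bullet> x = b}}"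

text \<open>Finiteness of \<open>P\<close> and \<open>H\<close> is part of the conclusion because
  the union bound over the classes relies on it.\<close>

lemma steep_incidence_bound:
  fixes C s t C\<^sub>P C\<^sub>H :: real and i :: "'n::finite"
  assumes d2: "CARD('n) \<ge> 2" and C: "C > 0"
    and s: "s > (real CARD('n) + 1) / 2" and t: "t > (real CARD('n) + 1) / 2"
    and CP: "C\<^sub>P > 0" and CH: "C\<^sub>H > 0"
  shows "\<exists>K>0. \<forall>\<delta> (P :: (real ^ 'n) set) (H :: (real ^ 'n) set set).
      P \<subseteq> cball 0 1 \<and>
      Metric_space.separated UNIV dist \<delta> P \<and>
      Metric_space.delta_set UNIV dist \<delta> s C\<^sub>P P \<and>
      H \<subseteq> hyperplanes \<and> (\<forall>V\<in>H. V \<inter> cball 0 1 \<noteq> {}) \<and>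
      Metric_space.separated hyperplanes hyperplane_dist \<delta> H \<and>
      Metric_space.delta_set hyperplanes hyperplane_dist \<delta> t C\<^sub>H H
      \<longrightarrow> finite P \<and> finite H \<and>
        real (incidences (C * \<delta>) P (H \<inter> steep_hyperplanes i)) \<le> K * \<delta> * real (card P) * real (card H)"
proof -
  interpret MH: Metric_space "hyperplanes :: (real ^ 'n) set set" hyperplane_dist by (rule Metric_space_hyperplanes)
  define D where "D = real CARD('n)"
  have D: "D \<ge> 2" using d2 by (simp add: D_def)
  define J where "J = UNIV - {i}"
  define \<beta> where "\<beta> = card J / 2 + 1"
  have \<beta>: "\<beta> = (D + 1) / 2" using d2 by (simp add: \<beta>_def J_def D_def card_Diff_singleton field_simps)
  have \<beta>0: "\<beta> > 0" "\<beta> < s" "\<beta> < t" using s t D by (auto simp: \<beta> D_def)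
  define IH where "IH = insert None (Some ` (Basis :: (real ^ 'n) set)) \<times> (UNIV :: 'n set)"
  \<comment> \<open>The scale of the defect. The intercepts b are at most D in size, so their scaled
    differences are at most 1; the scaled slopes are at most 1/4; and |a| \<le> D in the
    neighbourhood condition becomes a factor of at most 1/2, so the incidence threshold stays below
    C \<delta>.\<close>
  define \<eta> where "\<eta> = 1 / (2 * D)"
  have \<eta>: "0 < \<eta>" "\<eta> \<le> 1 / 4" using D by (auto simp: \<eta>_def field_simps)
  \<comment> \<open>The loss between coefficients and metric: 1 + 2 * D from
    \<open>hyperplane_dist_le\<close>, times 2 / \<eta> = 4 * D from undoing the scaling of slopes
    and intercept. The same value covers the points, whose loss is 2 * D + 1.\<close>
  define \<kappa> where "\<kappa> = 1 / (4 * D * (1 + 2 * D))"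
  have \<kappa>: "\<kappa> > 0" using D by (simp add: \<kappa>_def)
  define QP where "QP = \<kappa> powr (- \<beta>) * (1 + (2 * real (card (UNIV :: 'n set)) + 3) ^ card (UNIV :: 'n set) * C\<^sub>P * 2 powr \<beta> / (1 - 2 powr (\<beta> - s)))"
  define QH where "QH = \<kappa> powr (- \<beta>) * (1 + (2 * real (card IH) + 3) ^ card IH * C\<^sub>H * 2 powr \<beta> / (1 - 2 powr (\<beta> - t)))"
  have QP: "QP > 0" unfolding QP_def using \<kappa> CP \<beta>0
    by (intro mult_pos_pos add_pos_nonneg divide_nonneg_nonneg mult_nonneg_nonneg) (auto intro!: less_imp_le[OF powr_less_one])
  have QH: "QH > 0" unfolding QH_def using \<kappa> CH \<beta>0
    by (intro mult_pos_pos add_pos_nonneg divide_nonneg_nonneg mult_nonneg_nonneg) (auto intro!: less_imp_le[OF powr_less_one])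
  define E where "E = QP + QH"
  have E: "E > 0" using QP QH by (simp add: E_def)
  obtain K where K: "K > 0" and bound: "\<And>\<delta> (X :: (real ^ 'n) set) (Y :: (real ^ 'n) set set) w x z m A B.
    0 < \<delta> \<and> \<delta> \<le> 1 \<and> 0 < A \<and> 0 < B \<and> finite X \<and> finite Y \<and> real (card X) \<le> A \<and> real (card Y) \<le> B \<and>
    (\<forall>p\<in>X. \<forall>j\<in>J. \<bar>x p j\<bar> \<le> 1) \<and> (\<forall>h\<in>Y. \<forall>j\<in>J. \<bar>m h j\<bar> \<le> 1) \<and>
    (\<forall>p\<in>X. \<forall>q\<in>X. \<bar>w p - w q\<bar> \<le> 1 \<and> L2_set (\<lambda>j. x p j - x q j) J \<le> 2) \<and>
    (\<forall>g\<in>Y. \<forall>h\<in>Y. \<bar>z g - z h\<bar> \<le> 1 \<and> L2_set (\<lambda>j. m g j - m h j) J \<le> 2) \<and>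
    (\<Sum>p\<in>X. \<Sum>q\<in>X. (max \<delta> (max \<bar>w p - w q\<bar> (L2_set (\<lambda>j. x p j - x q j) J))) powr (- \<beta>)) \<le> E * A\<^sup>2 \<and>
    (\<Sum>g\<in>Y. \<Sum>h\<in>Y. (max \<delta> (max \<bar>z g - z h\<bar> (L2_set (\<lambda>j. m g j - m h j) J))) powr (- \<beta>)) \<le> E * B\<^sup>2
    \<Longrightarrow> real (card {(p, h). p \<in> X \<and> h \<in> Y \<and> \<bar>w p - z h - (\<Sum>j\<in>J. m h j * x p j)\<bar> \<le> C * \<delta>}) \<le> K * \<delta> * A * B"
    using energy_incidence_bound[of J C E, OF _ C E, where 'a = "real ^ 'n" and 'b = "(real ^ 'n) set"]
    unfolding \<beta>_def[symmetric] by auto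
  show ?thesis
  proof (intro exI[of _ K] conjI[OF K] allI impI, elim conjE)
    fix \<delta> and P :: "(real ^ 'n) set" and H :: "(real ^ 'n) set set"
    assume PB: "P \<subseteq> cball 0 1" and Psep: "Met_TC.separated \<delta> P" and Pset: "Met_TC.delta_set \<delta> s C\<^sub>P P"
      and HH: "H \<subseteq> hyperplanes" and HB: "\<forall>V\<in>H. V \<inter> cball 0 1 \<noteq> {}"
      and Hsep: "MH.separated \<delta> H" and Hset: "MH.delta_set \<delta> t C\<^sub>H H"
    have \<delta>: "0 < \<delta>" "\<delta> \<le> 1" using Pset by (auto simp: Met_TC.delta_set_def)
    have upP: "dist x y \<le> (\<Sum>j\<in>UNIV. \<bar>x $ j - y $ j\<bar>)" for x y :: "real ^ 'n"
      using norm_le_l1_cart[of "x - y"] by (simp add: dist_norm)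
    have lipP: "\<bar>x $ j - y $ j\<bar> \<le> dist x y" for x y :: "real ^ 'n" and j
      using component_le_norm_cart[of "x - y" j] by (simp add: dist_norm)
    have finP: "finite P" by (rule Met_TC.delta_set_card_le(1)[OF Psep Pset _ upP lipP]) auto
    have finIH: "finite IH" by (simp add: IH_def)
    have upH: "hyperplane_dist V W \<le> (\<Sum>j\<in>IH. \<bar>hyperplane_coord j V - hyperplane_coord j W\<bar>)" for V W :: "(real ^ 'n) set"
      unfolding IH_def by (rule hyperplane_dist_le_coord)
    have lipH: "\<bar>hyperplane_coord j V - hyperplane_coord j W\<bar> \<le> hyperplane_dist V W" if "j \<in> IH" for j and V W :: "(real ^ 'n) set"
      using that unfolding IH_def by (rule hyperplane_coord_lipschitz)
    have finH: "finite H" by (rule MH.delta_set_card_le(1)[OF Hsep Hset finIH upH lipH])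
    define Y where "Y = H \<inter> steep_hyperplanes i"
    have "\<forall>V\<in>Y. \<exists>a b. a $ i = 1 \<and> (\<forall>j. \<bar>a $ j\<bar> \<le> 1) \<and> V = {x. a \<bullet> x = b}"
      by (auto simp: Y_def steep_hyperplanes_def)
    then obtain a b where ab: "\<And>V. V \<in> Y \<Longrightarrow> a V $ i = 1" "\<And>V j. V \<in> Y \<Longrightarrow> \<bar>a V $ j\<bar> \<le> 1"
      "\<And>V. V \<in> Y \<Longrightarrow> V = {x. a V \<bullet> x = b V}" by metis
    have a1: "norm (a V) \<ge> 1" if "V \<in> Y" for V
      using component_le_norm_cart[of "a V" i] ab(1)[OF that] by simp
    have aD: "norm (a V) \<le> D" if "V \<in> Y" for V
    proof -
      have "norm (a V) \<le> (\<Sum>j\<in>UNIV. \<bar>a V $ j\<bar>)" by (rule norm_le_l1_cart)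
      also have "\<dots> \<le> (\<Sum>j\<in>(UNIV :: 'n set). 1)" using ab(2)[OF that] by (intro sum_mono) auto
      finally show ?thesis by (simp add: D_def)
    qed
    have bD: "\<bar>b V\<bar> \<le> D" if V: "V \<in> Y" for V
    proof -
      have "V \<inter> cball 0 1 \<noteq> {}" using HB V by (auto simp: Y_def)
      then obtain x where x: "x \<in> V" "norm x \<le> 1" by auto
      have "a V \<bullet> x = b V" using equalityD1[OF ab(3)[OF V], THEN subsetD, OF x(1)] by simp
      hence "\<bar>b V\<bar> = \<bar>a V \<bullet> x\<bar>" by simp
      also have "\<dots> \<le> norm (a V) * norm x" by (rule Cauchy_Schwarz_ineq2)
      also have "\<dots> \<le> D * 1" using aD[OF V] x D by (intro mult_mono) auto
      finally show ?thesis by simp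
    qed
    \<comment> \<open>In the products m x the factor \<eta> sits in the slopes, so the
      \<open>x\<close> stay unscaled. The sign of \<open>m\<close> makes the defect equal to \<eta>
      (a \<bullet> p - b).\<close>
    define w where "w = (\<lambda>p :: real ^ 'n. \<eta> * p $ i)"
    define x where "x = (\<lambda>(p :: real ^ 'n) j. p $ j)"
    define z where "z = (\<lambda>V. \<eta> * b V)"
    define m where "m = (\<lambda>V j. - (\<eta> * a V $ j))"
    have eqn: "w p - z V - (\<Sum>j\<in>J. m V j * x p j) = \<eta> * (a V \<bullet> p - b V)" if "V \<in> Y" for p V
    proof -
      have "a V \<bullet> p = a V $ i * p $ i + (\<Sum>j\<in>J. a V $ j * p $ j)"
        by (simp add: inner_vec_def J_def sum.remove[of UNIV i])
      thus ?thesis using ab(1)[OF that]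
        by (simp add: w_def z_def m_def x_def sum_negf sum_distrib_left algebra_simps)
    qed
    have near: "\<bar>w p - z V - (\<Sum>j\<in>J. m V j * x p j)\<bar> \<le> C * \<delta>" if V: "V \<in> Y" and p: "p \<in> nbhd V (C * \<delta>)" for p V
    proof -
      have "V \<noteq> {}" using HB V by (auto simp: Y_def)
      hence "\<bar>a V \<bullet> p - b V\<bar> \<le> norm (a V) * (C * \<delta>)"
        by (rule nbhd_hyperplane_abs_le[OF ab(3)[OF V] p])
      also have "\<dots> \<le> D * (C * \<delta>)" using aD[OF V] C \<delta> by (intro mult_right_mono) auto
      finally have "\<eta> * \<bar>a V \<bullet> p - b V\<bar> \<le> \<eta> * (D * (C * \<delta>))" using \<eta> by (intro mult_left_mono) auto
      also have "\<dots> = C * \<delta> / 2" using D by (simp add: \<eta>_def)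
      also have "\<dots> \<le> C * \<delta>" using C \<delta> by simp
      finally show ?thesis using \<eta> unfolding eqn[OF V] by (simp add: abs_mult)
    qed
    have xsmall: "\<bar>x p j\<bar> \<le> 1" if "p \<in> P" for p j
      using PB that component_le_norm_cart[of p j] by (auto simp: x_def)
    have msmall: "\<bar>m V j\<bar> \<le> \<eta>" if "V \<in> Y" for V j
      using ab(2)[OF that, of j] \<eta> by (simp add: m_def abs_mult mult_left_le)
    have Lx: "L2_set (\<lambda>j. x p j - x q j) J \<le> dist p q" "dist p q \<le> \<bar>p $ i - q $ i\<bar> + L2_set (\<lambda>j. x p j - x q j) J" for p q
      using L2_set_remove_le[where v = "p - q" and i = i] by (simp_all add: x_def J_def dist_norm)
    have wz: "\<bar>w p - w q\<bar> = \<eta> * \<bar>p $ i - q $ i\<bar>" "\<bar>z V - z W\<bar> = \<eta> * \<bar>b V - b W\<bar>" for p q V W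
      using \<eta> by (simp_all add: w_def z_def abs_mult flip: right_diff_distrib)
    have Lm: "norm (a V - a W) \<le> L2_set (\<lambda>j. m V j - m W j) J / \<eta>" if "V \<in> Y" "W \<in> Y" for V W
    proof -
      have "L2_set (\<lambda>j. m V j - m W j) J = L2_set (\<lambda>j. \<eta> * (a V - a W) $ j) J"
        by (simp add: m_def L2_set_def power2_commute algebra_simps)
      also have "\<dots> = \<eta> * L2_set (\<lambda>j. (a V - a W) $ j) J"
        using \<eta> by (simp only: L2_set_right_distrib less_imp_le)
      \<comment> \<open>Both normals have i-th component 1, so leaving out coordinate i loses
        nothing.\<close>
      finally show ?thesis using L2_set_remove_le(2)[of "a V - a W" i] ab(1)[OF that(1)] ab(1)[OF that(2)] \<eta>
        by (simp add: J_def)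
    qed
    have kP: "\<kappa> * max \<delta> (dist p q) \<le> max \<delta> (max \<bar>w p - w q\<bar> (L2_set (\<lambda>j. x p j - x q j) J))" for p q
    proof -
      define M where "M = max \<delta> (max \<bar>w p - w q\<bar> (L2_set (\<lambda>j. x p j - x q j) J))"
      have M: "\<delta> \<le> M" "\<bar>w p - w q\<bar> \<le> M" "L2_set (\<lambda>j. x p j - x q j) J \<le> M" "M > 0" using \<delta> by (auto simp: M_def)
      have "\<bar>p $ i - q $ i\<bar> \<le> M / \<eta>" using M(2) \<eta> unfolding wz by (simp add: field_simps)
      hence "dist p q \<le> M / \<eta> + M" using Lx(2)[of p q] M(3) by linarith
      also have "\<dots> = (2 * D + 1) * M" by (simp add: \<eta>_def algebra_simps)
      also have "\<dots> \<le> M / \<kappa>"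
      proof -
        have "1 * (2 * D + 1) * M \<le> (4 * D) * (2 * D + 1) * M" using D M(4) by (intro mult_right_mono) auto
        thus ?thesis by (simp add: \<kappa>_def algebra_simps)
      qed
      finally have 1: "dist p q \<le> M / \<kappa>" .
      have "\<kappa> \<le> 1" unfolding \<kappa>_def using D mult_mono[of 1 "4 * D" 1 "1 + 2 * D"] by (simp add: divide_le_eq)
      hence "\<kappa> * \<delta> \<le> 1 * M" using M(1) \<delta> \<kappa> by (intro mult_mono) auto
      moreover have "\<kappa> * dist p q \<le> M" using 1 \<kappa> by (simp add: field_simps)
      ultimately show ?thesis unfolding M_def[symmetric] by (simp add: max_def)
    qed
    have kH: "\<kappa> * max \<delta> (hyperplane_dist V W) \<le> max \<delta> (max \<bar>z V - z W\<bar> (L2_set (\<lambda>j. m V j - m W j) J))"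
      if VW: "V \<in> Y" "W \<in> Y" for V W
    proof -
      define M where "M = max \<delta> (max \<bar>z V - z W\<bar> (L2_set (\<lambda>j. m V j - m W j) J))"
      have M: "\<delta> \<le> M" "\<bar>z V - z W\<bar> \<le> M" "L2_set (\<lambda>j. m V j - m W j) J \<le> M" "M > 0" using \<delta> by (auto simp: M_def)
      have "\<bar>b V - b W\<bar> \<le> M / \<eta>" using M(2) \<eta> unfolding wz by (simp add: field_simps)
      moreover have "norm (a V - a W) \<le> M / \<eta>"
        using Lm[OF VW] divide_right_mono[OF M(3), of \<eta>] \<eta> by linarith
      ultimately have "norm (a V - a W) + \<bar>b V - b W\<bar> \<le> M / \<eta> + M / \<eta>" by linarith
      also have "\<dots> = 4 * D * M" by (simp add: \<eta>_def)
      finally have "norm (a V - a W) + \<bar>b V - b W\<bar> \<le> 4 * D * M" .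
      hence "(1 + 2 * D) * (norm (a V - a W) + \<bar>b V - b W\<bar>) \<le> (1 + 2 * D) * (4 * D * M)"
        using D by (intro mult_left_mono) auto
      moreover have "hyperplane_dist V W \<le> (1 + 2 * D) * (norm (a V - a W) + \<bar>b V - b W\<bar>)"
        by (rule hyperplane_dist_le[OF a1 aD a1 bD ab(3) ab(3)]) (use VW in auto)
      ultimately have "hyperplane_dist V W \<le> M / \<kappa>" by (simp add: \<kappa>_def mult_ac)
      hence "\<kappa> * hyperplane_dist V W \<le> M" using \<kappa> by (simp add: field_simps)
      moreover have "\<kappa> \<le> 1" unfolding \<kappa>_def using D mult_mono[of 1 "4 * D" 1 "1 + 2 * D"] by (simp add: divide_le_eq)
      hence "\<kappa> * \<delta> \<le> 1 * M" using M(1) \<delta> \<kappa> by (intro mult_mono) auto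
      ultimately show ?thesis unfolding M_def[symmetric] by (simp add: max_def)
    qed
    have energyP: "(\<Sum>p\<in>P. \<Sum>q\<in>P. (max \<delta> (max \<bar>w p - w q\<bar> (L2_set (\<lambda>j. x p j - x q j) J))) powr (- \<beta>)) \<le> QP * (real (card P))\<^sup>2"
      unfolding QP_def by (rule Met_TC.delta_set_energy_le[OF Psep Pset _ upP lipP \<beta>0(1,2) _ \<kappa> kP]) auto
    have energyH: "(\<Sum>g\<in>Y. \<Sum>h\<in>Y. (max \<delta> (max \<bar>z g - z h\<bar> (L2_set (\<lambda>j. m g j - m h j) J))) powr (- \<beta>)) \<le> QH * (real (card H))\<^sup>2"
      unfolding QH_def by (rule MH.delta_set_energy_le[OF Hsep Hset finIH upH lipH \<beta>0(1,3) _ \<kappa> kH]) (auto simp: Y_def)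
    have finY: "finite Y" using finH by (simp add: Y_def)
    have inc: "real (incidences (C * \<delta>) P Y) \<le> K * \<delta> * real (card P) * real (card H)"
    \<comment> \<open>The analytic bound is applied with A = card P and B = card H, which have to be
      positive.\<close>
    proof (cases "P = {} \<or> H = {}")
      case True
      hence "{(p, V). p \<in> P \<and> V \<in> Y \<and> p \<in> nbhd V (C * \<delta>)} = {}" by (auto simp: Y_def)
      thus ?thesis using K \<delta> by (simp only: incidences_def) simp
    next
      case False
      have "incidences (C * \<delta>) P Y \<le> card {(p, h). p \<in> P \<and> h \<in> Y \<and> \<bar>w p - z h - (\<Sum>j\<in>J. m h j * x p j)\<bar> \<le> C * \<delta>}"
        unfolding incidences_def
      proof (rule card_mono)
        show "finite {(p, h). p \<in> P \<and> h \<in> Y \<and> \<bar>w p - z h - (\<Sum>j\<in>J. m h j * x p j)\<bar> \<le> C * \<delta>}"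
          by (rule finite_subset[of _ "P \<times> Y"]) (use finP finY in auto)
      qed (use near in blast)
      hence "real (incidences (C * \<delta>) P Y) \<le> real (card {(p, h). p \<in> P \<and> h \<in> Y \<and> \<bar>w p - z h - (\<Sum>j\<in>J. m h j * x p j)\<bar> \<le> C * \<delta>})"
        by (simp only: of_nat_le_iff)
      also have "\<dots> \<le> K * \<delta> * real (card P) * real (card H)"
      proof (rule bound, intro conjI ballI)
        show "0 < \<delta>" "\<delta> \<le> 1" "finite P" "finite Y" using \<delta> finP finY by auto
        show "0 < real (card P)" "0 < real (card H)" using False finP finH by (auto simp: card_gt_0_iff)
        show "real (card Y) \<le> real (card H)" using finH by (auto simp: Y_def intro!: card_mono)
        show "(\<Sum>p\<in>P. \<Sum>q\<in>P. (max \<delta> (max \<bar>w p - w q\<bar> (L2_set (\<lambda>j. x p j - x q j) J))) powr (- \<beta>)) \<le> E * (real (card P))\<^sup>2"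
          using energyP QH by (elim order_trans, intro mult_right_mono) (auto simp: E_def)
        show "(\<Sum>g\<in>Y. \<Sum>h\<in>Y. (max \<delta> (max \<bar>z g - z h\<bar> (L2_set (\<lambda>j. m g j - m h j) J))) powr (- \<beta>)) \<le> E * (real (card H))\<^sup>2"
          using energyH QP by (elim order_trans, intro mult_right_mono) (auto simp: E_def)
      next
        fix p j assume "p \<in> P" thus "\<bar>x p j\<bar> \<le> 1" by (rule xsmall)
      next
        fix h j assume "h \<in> Y" thus "\<bar>m h j\<bar> \<le> 1" using msmall[of h j] \<eta> by linarith
      next
        fix p q assume pq: "p \<in> P" "q \<in> P"
        have "\<bar>p $ i - q $ i\<bar> \<le> 2" using xsmall[OF pq(1), of i] xsmall[OF pq(2), of i] by (auto simp: x_def)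
        hence "\<eta> * \<bar>p $ i - q $ i\<bar> \<le> (1 / 4) * 2" using \<eta> by (intro mult_mono) auto
        thus "\<bar>w p - w q\<bar> \<le> 1" unfolding wz by simp
        have "dist p 0 \<le> 1" "dist 0 q \<le> 1" using PB pq by auto
        hence "dist p q \<le> 2" using dist_triangle[of p q 0] by linarith
        thus "L2_set (\<lambda>j. x p j - x q j) J \<le> 2" using Lx(1)[of p q] by linarith
      next
        fix g h assume gh: "g \<in> Y" "h \<in> Y"
        have "\<bar>b g - b h\<bar> \<le> 2 * D" using bD[OF gh(1)] bD[OF gh(2)] by linarith
        hence "\<eta> * \<bar>b g - b h\<bar> \<le> \<eta> * (2 * D)" using \<eta> by (intro mult_left_mono) auto
        thus "\<bar>z g - z h\<bar> \<le> 1" unfolding wz using D by (simp add: \<eta>_def)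
        have "L2_set (\<lambda>j. m g j - m h j) J \<le> (\<Sum>j\<in>J. \<bar>m g j - m h j\<bar>)" by (rule L2_set_le_sum_abs)
        also have "\<dots> \<le> (\<Sum>j\<in>J. 2 * \<eta>)"
        proof (rule sum_mono)
          fix j show "\<bar>m g j - m h j\<bar> \<le> 2 * \<eta>" using msmall[OF gh(1), of j] msmall[OF gh(2), of j] by linarith
        qed
        also have "\<dots> \<le> D * (2 * \<eta>)" using \<eta> unfolding sum_constant by (intro mult_right_mono) (auto simp: J_def D_def card_mono)
        also have "\<dots> = 1" using D by (simp add: \<eta>_def)
        finally show "L2_set (\<lambda>j. m g j - m h j) J \<le> 2" by simp
      qed simp
      finally show ?thesis .
    qed
    show "finite P \<and> finite H \<and>
        real (incidences (C * \<delta>) P (H \<inter> steep_hyperplanes i)) \<le> K * \<delta> * real (card P) * real (card H)"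
      using inc finP finH unfolding Y_def by blast
  qed
qed

theorem theorem1p4:
  fixes C s t :: real
  assumes "CARD('n::finite) \<ge> 2"
    and "C > 0"
    and "0 \<le> s" "s \<le> real CARD('n)"
    and "0 \<le> t" "t \<le> real CARD('n)"
    and "s > (real CARD('n) + 1) / 2"
    and "t > (real CARD('n) + 1) / 2"
  shows "\<exists>\<delta>\<^sub>0>0. \<forall>C\<^sub>P>0. \<forall>C\<^sub>H>0. \<exists>K>0.
    \<forall>\<delta> (P :: (real ^ 'n) set) (H :: (real ^ 'n) set set).
      0 < \<delta> \<and> \<delta> < \<delta>\<^sub>0 \<and>
      P \<subseteq> cball 0 1 \<and>
      Metric_space.separated UNIV dist \<delta> P \<and>
      Metric_space.delta_set UNIV dist \<delta> s C\<^sub>P P \<and>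
      H \<subseteq> hyperplanes \<and> (\<forall>V\<in>H. V \<inter> cball 0 1 \<noteq> {}) \<and>
      Metric_space.separated hyperplanes hyperplane_dist \<delta> H \<and>
      Metric_space.delta_set hyperplanes hyperplane_dist \<delta> t C\<^sub>H H
      \<longrightarrow> real (incidences (C * \<delta>) P H) \<le> K * \<delta> * real (card P) * real (card H)"
proof (rule exI[of _ 1], rule conjI[OF zero_less_one], intro allI impI)
  \<comment> \<open>The threshold 1 serves for all parameters because the bound for each class is
    uniform over 0 < \<delta> \<le> 1.\<close>
  fix C\<^sub>P C\<^sub>H :: real assume CP: "C\<^sub>P > 0" and CH: "C\<^sub>H > 0"
  define admissible where "admissible = (\<lambda>\<delta> (P :: (real ^ 'n) set) (H :: (real ^ 'n) set set).
    P \<subseteq> cball 0 1 \<and>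
    Metric_space.separated UNIV dist \<delta> P \<and>
    Metric_space.delta_set UNIV dist \<delta> s C\<^sub>P P \<and>
    H \<subseteq> hyperplanes \<and> (\<forall>V\<in>H. V \<inter> cball 0 1 \<noteq> {}) \<and>
    Metric_space.separated hyperplanes hyperplane_dist \<delta> H \<and>
    Metric_space.delta_set hyperplanes hyperplane_dist \<delta> t C\<^sub>H H)"
  have "\<forall>i. \<exists>K>0. \<forall>\<delta> P H. admissible \<delta> P H \<longrightarrow> finite P \<and> finite H \<and>
      real (incidences (C * \<delta>) P (H \<inter> steep_hyperplanes i)) \<le> K * \<delta> * real (card P) * real (card H)"
    unfolding admissible_def using steep_incidence_bound[OF assms(1,2,7,8) CP CH] by blast
  then obtain K where K: "\<And>i. K i > 0" and fin: "\<And>\<delta> P H. admissible \<delta> P H \<Longrightarrow> finite P \<and> finite H"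
    and bound: "\<And>i \<delta> P H. admissible \<delta> P H \<Longrightarrow>
      real (incidences (C * \<delta>) P (H \<inter> steep_hyperplanes i)) \<le> K i * \<delta> * real (card P) * real (card H)"
    unfolding choice_iff by blast
  have main: "real (incidences (C * \<delta>) P H) \<le> (\<Sum>i\<in>UNIV. K i) * \<delta> * real (card P) * real (card H)"
    if PH: "admissible \<delta> P H" for \<delta> P H
  proof -
    define S where "S = (\<lambda>H. {(p, V). p \<in> P \<and> V \<in> H \<and> p \<in> nbhd V (C * \<delta>)})"
    have "H \<subseteq> hyperplanes" using PH by (simp add: admissible_def)
    hence "H \<subseteq> (\<Union>i. steep_hyperplanes i)"
      using hyperplane_normal_form by (fastforce simp: steep_hyperplanes_def)
    hence "S H \<subseteq> (\<Union>i. S (H \<inter> steep_hyperplanes i))" by (fastforce simp: S_def)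
    moreover have "finite (S (H \<inter> A))" for A
      by (rule finite_subset[of _ "P \<times> H"]) (use fin[OF PH] in \<open>auto simp: S_def\<close>)
    ultimately have "card (S H) \<le> card (\<Union>i. S (H \<inter> steep_hyperplanes i))"
      by (intro card_mono) auto
    also have "\<dots> \<le> (\<Sum>i\<in>UNIV. card (S (H \<inter> steep_hyperplanes i)))" by (rule card_UN_le) simp
    finally have "real (incidences (C * \<delta>) P H) \<le> (\<Sum>i\<in>UNIV. real (incidences (C * \<delta>) P (H \<inter> steep_hyperplanes i)))"
      unfolding incidences_def S_def by (simp flip: of_nat_sum)
    also have "\<dots> \<le> (\<Sum>i\<in>UNIV. K i * \<delta> * real (card P) * real (card H))" by (intro sum_mono bound PH)
    finally show ?thesis by (simp add: sum_distrib_right)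
  qed
  have "(\<Sum>i\<in>UNIV. K i) > 0" using K by (intro sum_pos) auto
  with main show "\<exists>K>0. \<forall>\<delta> (P :: (real ^ 'n) set) (H :: (real ^ 'n) set set).
      0 < \<delta> \<and> \<delta> < 1 \<and>
      P \<subseteq> cball 0 1 \<and>
      Metric_space.separated UNIV dist \<delta> P \<and>
      Metric_space.delta_set UNIV dist \<delta> s C\<^sub>P P \<and>
      H \<subseteq> hyperplanes \<and> (\<forall>V\<in>H. V \<inter> cball 0 1 \<noteq> {}) \<and>
      Metric_space.separated hyperplanes hyperplane_dist \<delta> H \<and>
      Metric_space.delta_set hyperplanes hyperplane_dist \<delta> t C\<^sub>H H
      \<longrightarrow> real (incidences (C * \<delta>) P H) \<le> K * \<delta> * real (card P) * real (card H)"
    unfolding admissible_def by blast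
qed

end
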